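(* For any integers $m,n\ge 0$ and complex numbers $a,b$, define $$U_m(b)=\sum_{k=0}^{\infty}\frac{(q^{1-m};q)_k}{(q;q)_k\,(bq^{k};q)_m}\,(1-bq^{2k})\,b^{2k}q^{2k^2-k+mk},$$ $$V_{m,n}(a,b)={}_2\phi_1\left[\begin{matrix}q^{-m},&q^{-n}\\ &abq^{n-1}\end{matrix};q,\,bq^{m+n}\right].$$ Then for every integer $m\ge 0$, $$U_m(b)\,\theta(q,a)=(q,a,b;q)_\infty\sum_{n=0}^\infty\frac{(abq^{n-1};q)_n\,q^n}{(q;q)_n(a;q)_n}\cdot\frac{V_{m,n}(a,b)}{(b;q)_{m+n}}.$$
   Context: Here $q$ is a fixed complex number with $0<|q|<1$, and parameters are assumed to be such that no denominator vanishes. Notation: $(x;q)_\infty=\prod_{n\ge0}(1-xq^n)$, $(x;q)_n=(x;q)_\infty/(xq^n;q)_\infty$ (so $(x;q)_n=\prod_{i=0}^{n-1}(1-xq^i)$ for $n\ge 0$), and $(a_1,\ldots,a_m;q)_n=(a_1;q)_n\cdots(a_m;q)_n$ for $n$ an integer or $\infty$. The partial theta function is $\theta(q,x)=\sum_{n=0}^\infty\tau(n)x^n$ with $\tau(n)=(-1)^nq^{n(n-1)/2}$. The $q$-Heine series is ${}_2\phi_1\left[\begin{matrix}A,&B\\&C\end{matrix};q,x\right]=\sum_{k=0}^\infty\frac{(A,B;q)_k}{(C;q)_k}\frac{x^k}{(q;q)_k}$; when $A=q^{-m}$ and $B=q^{-n}$ it terminates, and is read as the finite sum over $0\le k\le\min(m,n)$.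 *)

theory Defs
  imports "HOL-Analysis.Analysis"
begin

definition qpoch :: "complex \<Rightarrow> complex \<Rightarrow> nat \<Rightarrow> complex" where
  "qpoch x q n = (\<Prod>i<n. 1 - x * q ^ i)"

definition qpoch_inf :: "complex \<Rightarrow> complex \<Rightarrow> complex" where
  "qpoch_inf x q = (\<Prod>n. 1 - x * q ^ n)"

definition partial_theta_coeff :: "complex \<Rightarrow> nat \<Rightarrow> complex" where
  "partial_theta_coeff q n = (-1) ^ n * q ^ (n * (n - 1) div 2)"

definition partial_theta :: "complex \<Rightarrow> complex \<Rightarrow> complex" where
  "partial_theta q x = (\<Sum>n. partial_theta_coeff q n * x ^ n)"

text \<open>
  If \<open>A = q\<^sup>-\<^sup>m\<close> and \<open>B = q\<^sup>-\<^sup>n\<close>, the numerator vanishes for \<open>k > min m n\<close>, so by the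
  convention \<open>0 / 0 = 0\<close> those terms are zero even where \<open>(C;q)\<^sub>k = 0\<close>; the series is then
  the finite sum over \<open>k \<le> min m n\<close>, see \<open>V_eq_finite_sum\<close> below.
\<close>

definition heine_phi :: "complex \<Rightarrow> complex \<Rightarrow> complex \<Rightarrow> complex \<Rightarrow> complex \<Rightarrow> complex" where
  "heine_phi A B C q x =
     (\<Sum>k. qpoch A q k * qpoch B q k / qpoch C q k * (x ^ k / qpoch q q k))"

text \<open>
  The natural-number exponent \<open>2 * k\<^sup>2 - k + m * k\<close> is not truncated, since \<open>k \<le> 2 * k\<^sup>2\<close>.
\<close>

definition U_term :: "complex \<Rightarrow> nat \<Rightarrow> complex \<Rightarrow> nat \<Rightarrow> complex" where
  "U_term q m b k =
     qpoch (q powi (1 - int m)) q k / (qpoch q q k * qpoch (b * q ^ k) q m)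
       * (1 - b * q ^ (2 * k)) * b ^ (2 * k) * q ^ (2 * k\<^sup>2 - k + m * k)"

definition U :: "complex \<Rightarrow> nat \<Rightarrow> complex \<Rightarrow> complex" where
  "U q m b = (\<Sum>k. U_term q m b k)"

definition V :: "complex \<Rightarrow> nat \<Rightarrow> nat \<Rightarrow> complex \<Rightarrow> complex \<Rightarrow> complex" where
  "V q m n a b =
     heine_phi (q powi (- int m)) (q powi (- int n)) (a * b * q powi (int n - 1)) q
       (b * q ^ (m + n))"

lemma qpoch_neg_power_eq_0:
  assumes "q \<noteq> 0" "m < k"
  shows "qpoch (q powi (- int m)) q k = 0"
proof -
  have "1 - q powi (- int m) * q ^ m = 0"
    using assms by (simp add: power_int_minus)
  then show ?thesis
    using assms unfolding qpoch_def by (intro prod_zero) auto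
qed

lemma V_eq_finite_sum:
  assumes "q \<noteq> 0"
  shows "V q m n a b =
    (\<Sum>k\<le>min m n. qpoch (q powi (- int m)) q k * qpoch (q powi (- int n)) q k
       / qpoch (a * b * q powi (int n - 1)) q k * ((b * q ^ (m + n)) ^ k / qpoch q q k))"
  unfolding V_def heine_phi_def
  by (rule suminf_finite) (auto simp: qpoch_neg_power_eq_0[OF assms] min_def split: if_splits)

end

theory Submission
  imports Defs
begin

text \<open>
The difficulty is that \<open>a\<close> and \<open>b\<close> are entangled on the right-hand side, through
\<open>(a b q^(n-1); q)\<^sub>n\<close>, and must be separated. Put \<open>\<alpha> = q^(-m)\<close> and
\<open>c = b q\<^sup>m\<close>, so that \<open>b = c \<alpha>\<close>. Reversing \<open>(q^(-n); q)\<^sub>k\<close> turns the Heine series into a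
sum over \<open>k\<close> with coefficients \<open>(\<alpha>; q)\<^sub>k\<close> (lemma \<open>V_expansion\<close>), and the two infinite products
\<open>(a q\<^sup>n; q)\<^sub>\<infinity>\<close> and \<open>(c q\<^sup>n; q)\<^sub>\<infinity>\<close> that survive in the \<open>n\<close>-th term are expanded by Euler's
formula (\<open>euler_sums\<close>), while \<open>(a b q^(n-1+k); q)_(n-k)\<close> is expanded by the finite q-binomial theorem.
The right-hand side becomes an absolutely convergent five-fold series over \<open>(k, s, p, r, t)\<close> with
\<open>n = k + s + p\<close>. In this form the variable \<open>p\<close> enters only through a series
\<open>\<Sum>\<^sub>p x\<^sup>p / (q; q)\<^sub>p\<close>, which Euler's other formula evaluates. What remains is a power series in
\<open>a\<close> and \<open>c\<close>, the exponents being \<open>i = r + s\<close> and \<open>l = k + t + s\<close>.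

Its coefficient at \<open>a\<^sup>i c\<^sup>l\<close> is a finite double sum over \<open>k\<close> and \<open>s\<close>, and it factors. Up to
the factors \<open>\<tau>(i) \<tau>(l)\<close> it does not depend on \<open>i\<close> at all: its generating function
over \<open>i\<close> is a constant times \<open>1 / (1 - z)\<close>, because the partial sums of a certain
\<open>2\<phi>1\<close> series have closed form (lemmas \<open>fps_partial_2phi1_sum\<close> and \<open>theta_coefficient_identity\<close>).
Hence the series equals \<open>\<theta>(q, a)\<close> times \<open>\<Sum>\<^sub>l \<tau>(l) c\<^sup>l (\<alpha> q; q)\<^sub>l / (q; q)\<^sub>l\<close>
(lemma \<open>n_term_sums\<close>, which holds for every complex \<open>\<alpha>\<close>).

It remains to recognise the last sum as \<open>U\<^sub>m(b)\<close> (lemma \<open>U_sums\<close>). For \<open>m = 0\<close> it is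
\<open>\<theta>(q, b)\<close>, and pairing its terms of index \<open>2 k\<close> and \<open>2 k + 1\<close> gives the terms of \<open>U\<^sub>0\<close>.
For \<open>m \<ge> 1\<close> both sides are finite and satisfy \<open>f_(m+1)(b) = f\<^sub>m(b) + b q\<^sup>m f\<^sub>m(b q)\<close>. For the
sum over \<open>l\<close> this is a q-Pascal rule, for \<open>U\<^sub>m\<close> it follows by creative telescoping with an explicit
certificate (\<open>U_summand_telescopes\<close>).
\<close>

section \<open>q-Pochhammer symbols\<close>

lemma qpoch_0 [simp]: "qpoch x q 0 = 1"
  by (simp add: qpoch_def)

lemma qpoch_Suc: "qpoch x q (Suc n) = qpoch x q n * (1 - x * q ^ n)"
  by (simp add: qpoch_def)

lemma qpoch_Suc_shift: "qpoch x q (Suc n) = (1 - x) * qpoch (x * q) q n"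
  unfolding qpoch_def by (subst prod.lessThan_Suc_shift) (simp add: mult_ac)

lemma qpoch_add: "qpoch x q (m + n) = qpoch x q m * qpoch (x * q ^ m) q n"
  by (induction n) (simp_all add: qpoch_Suc power_add mult_ac)

lemma partial_theta_coeff_0 [simp]: "partial_theta_coeff q 0 = 1"
  by (simp add: partial_theta_coeff_def)

lemma triangle_Suc: "Suc n * (Suc n - 1) div 2 = n * (n - 1) div 2 + n"
proof -
  have "Suc n * (Suc n - 1) = n * (n - 1) + 2 * n"
    by (cases n) (auto simp: algebra_simps)
  then show ?thesis by simp
qed

lemma partial_theta_coeff_Suc:
  "partial_theta_coeff q (Suc n) = - (q ^ n) * partial_theta_coeff q n"
  unfolding partial_theta_coeff_def triangle_Suc by (simp add: power_add)

lemma partial_theta_coeff_add: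
  "partial_theta_coeff q (m + n) = partial_theta_coeff q m * partial_theta_coeff q n * q ^ (m * n)"
  by (induction n) (simp_all add: partial_theta_coeff_Suc power_add algebra_simps)

lemma sums_case_nat_0:
  fixes f :: "nat \<Rightarrow> 'a::real_normed_vector"
  assumes "f sums s"
  shows "case_nat 0 f sums s"
  using assms sums_Suc_iff[of "case_nat 0 f" s] by simp

section \<open>Unconditional sums over fibres and products\<close>

text \<open>
Summation by the values of \<open>g\<close>. It is applied to maps with finite fibres, where the inner sums
are finite sums.
\<close>

lemma has_sum_fibres:
  fixes f :: "'a \<Rightarrow> 'c::{topological_comm_monoid_add,t3_space}"
  assumes "(f has_sum S) UNIV" and "\<And>y. (f has_sum F y) {x. g x = y}"
  shows "(F has_sum S) UNIV"
proof (rule has_sum_SigmaD)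
  show "((\<lambda>(y, x). f x) has_sum S) (Sigma UNIV (\<lambda>y. {x. g x = y}))"
    using assms(1)
    by (subst has_sum_reindex_bij_witness[where i = "\<lambda>x. (g x, x)" and j = snd and T = UNIV and h = f and s' = S])
      auto
qed (use assms(2) in auto)

lemma abs_summable_on_times:
  fixes f :: "'a \<Rightarrow> 'c::{real_normed_div_algebra,banach}"
  assumes "(\<lambda>x. norm (f x)) summable_on A" "(\<lambda>y. norm (g y)) summable_on B"
  shows "(\<lambda>(x, y). norm (f x * g y)) summable_on A \<times> B"
proof (rule summable_on_SigmaI[where g = "\<lambda>x. norm (f x) * infsum (\<lambda>y. norm (g y)) B"])
  show "((\<lambda>y. case (x, y) of (x, y) \<Rightarrow> norm (f x * g y)) has_sum norm (f x) * (\<Sum>\<^sub>\<infinity>y\<in>B. norm (g y))) B" for x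
    unfolding split norm_mult by (intro has_sum_cmult_right has_sum_infsum assms)
  show "(\<lambda>x. norm (f x) * (\<Sum>\<^sub>\<infinity>y\<in>B. norm (g y))) summable_on A"
    by (intro summable_on_cmult_left assms)
qed auto

lemma has_sum_times:
  fixes f :: "'a \<Rightarrow> complex"
  assumes "(\<lambda>x. norm (f x)) summable_on A" "(\<lambda>y. norm (g y)) summable_on B"
    and "(f has_sum s) A" "(g has_sum t) B"
  shows "((\<lambda>(x, y). f x * g y) has_sum (s * t)) (A \<times> B)"
proof (rule has_sum_SigmaI)
  show "((\<lambda>y. case (x, y) of (x, y) \<Rightarrow> f x * g y) has_sum f x * t) B" for x
    unfolding split by (rule has_sum_cmult_right[OF assms(4)])
  show "((\<lambda>x. f x * t) has_sum s * t) A"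
    by (rule has_sum_cmult_left[OF assms(3)])
  show "(\<lambda>(x, y). f x * g y) summable_on A \<times> B"
    using abs_summable_on_times[OF assms(1,2)]
    by (rule abs_summable_summable[OF iffD1[OF summable_on_cong], rotated]) (simp add: case_prod_unfold)
qed

section \<open>Infinite products and summability for a fixed nome\<close>

text \<open>
The value \<open>q\<close> is fixed throughout. The condition \<open>q \<noteq> 0\<close> matters because negative powers of \<open>q\<close> occur.
\<close>

locale nome =
  fixes q :: complex
  assumes q_pos: "0 < norm q" and q_less_1: "norm q < 1"
begin

lemma q_nz: "q \<noteq> 0"
  using q_pos by auto

lemma power_neq_1: "0 < n \<Longrightarrow> q ^ n \<noteq> 1"
  using q_less_1 q_pos by (metis norm_one norm_power power_Suc_less_one less_irrefl gr0_conv_Suc norm_ge_zero)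

lemma qq_nz [simp]: "qpoch q q n \<noteq> 0"
  using power_neq_1[of "Suc _"] unfolding qpoch_def by (auto simp flip: power_Suc)

lemma qq_Suc: "qpoch q q (Suc n) = qpoch q q n * (1 - q ^ Suc n)"
  by (simp add: qpoch_Suc)

lemma convergent_prod_qpoch: "convergent_prod (\<lambda>n. 1 - x * q ^ n)"
proof -
  have "summable (\<lambda>n. norm x * norm q ^ n)"
    by (intro summable_mult summable_geometric) (use q_less_1 in auto)
  then have "abs_convergent_prod (\<lambda>n. 1 - x * q ^ n)"
    by (simp add: abs_convergent_prod_conv_summable norm_mult norm_power)
  then show ?thesis by (rule abs_convergent_prod_imp_convergent_prod)
qed

lemma qpoch_LIMSEQ: "qpoch x q \<longlonglongrightarrow> qpoch_inf x q"
proof -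
  have "(\<lambda>n. qpoch x q (Suc n)) \<longlonglongrightarrow> qpoch_inf x q"
    using convergent_prod_LIMSEQ[OF convergent_prod_qpoch[of x]]
    by (simp add: qpoch_def qpoch_inf_def lessThan_Suc_atMost)
  then show ?thesis by (rule LIMSEQ_imp_Suc)
qed

lemma qpoch_inf_nz:
  assumes "\<And>n. qpoch x q n \<noteq> 0"
  shows "qpoch_inf x q \<noteq> 0"
  unfolding qpoch_inf_def
proof (rule prodinf_nonzero[OF convergent_prod_qpoch])
  show "1 - x * q ^ i \<noteq> 0" for i
    using assms[of "Suc i"] by (auto simp: qpoch_Suc)
qed

lemma qpoch_inf_split: "qpoch_inf x q = qpoch x q n * qpoch_inf (x * q ^ n) q"
proof (rule LIMSEQ_unique)
  show "(\<lambda>k. qpoch x q (k + n)) \<longlonglongrightarrow> qpoch_inf x q"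
    using qpoch_LIMSEQ by (rule LIMSEQ_ignore_initial_segment)
  have "(\<lambda>k. qpoch x q n * qpoch (x * q ^ n) q k) \<longlonglongrightarrow> qpoch x q n * qpoch_inf (x * q ^ n) q"
    by (intro tendsto_intros qpoch_LIMSEQ)
  then show "(\<lambda>k. qpoch x q (k + n)) \<longlonglongrightarrow> qpoch x q n * qpoch_inf (x * q ^ n) q"
    by (simp add: add.commute[of _ n] qpoch_add)
qed

lemma qpoch_bounded: "\<exists>K. \<forall>n. norm (qpoch x q n) \<le> K"
  using qpoch_LIMSEQ[of x] convergent_imp_Bseq[of "qpoch x q"]
  by (auto simp: convergent_def Bseq_def)

lemma inverse_qq_bounded: "\<exists>K. \<forall>n. norm (inverse (qpoch q q n)) \<le> K"
proof -
  have "(\<lambda>n. inverse (qpoch q q n)) \<longlonglongrightarrow> inverse (qpoch_inf q q)"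
    by (intro tendsto_inverse qpoch_LIMSEQ qpoch_inf_nz qq_nz)
  then show ?thesis
    using convergent_imp_Bseq[of "\<lambda>n. inverse (qpoch q q n)"] by (auto simp: convergent_def Bseq_def)
qed

section \<open>Euler expansions of infinite products\<close>

text \<open>
Ratio test: consecutive terms have the ratio \<open>|q|\<^sup>n |x|\<close>, which tends to 0 for every \<open>x\<close>.
\<close>

lemma summable_norm_theta: "summable (\<lambda>n. norm (partial_theta_coeff q n * x ^ n))"
proof -
  have "(\<lambda>n. norm q ^ n * norm x) \<longlonglongrightarrow> 0"
    using q_less_1 by (intro tendsto_mult_left_zero LIMSEQ_power_zero) auto
  then have "\<forall>\<^sub>F n in sequentially. norm q ^ n * norm x < 1/2"
    by (rule order_tendstoD) auto
  then obtain N where N: "\<And>n. n \<ge> N \<Longrightarrow> norm q ^ n * norm x < 1/2"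
    by (auto simp: eventually_sequentially)
  show ?thesis
  proof (rule summable_ratio_test[of "1/2" N])
    fix n assume "n \<ge> N"
    have "norm (partial_theta_coeff q (Suc n) * x ^ Suc n)
        = (norm q ^ n * norm x) * norm (partial_theta_coeff q n * x ^ n)"
      by (simp add: partial_theta_coeff_Suc norm_mult norm_power)
    also have "\<dots> \<le> 1/2 * norm (partial_theta_coeff q n * x ^ n)"
      using N[OF \<open>n \<ge> N\<close>] by (intro mult_right_mono) auto
    finally show "norm (norm (partial_theta_coeff q (Suc n) * x ^ Suc n))
        \<le> 1/2 * norm (norm (partial_theta_coeff q n * x ^ n))" by simp
  qed auto
qed

lemma summable_norm_weighted_theta:
  assumes "\<And>n. norm (w n) \<le> K"
  shows "summable (\<lambda>n. norm (w n * (partial_theta_coeff q n * x ^ n)))"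
proof (rule summable_comparison_test')
  show "summable (\<lambda>n. K * norm (partial_theta_coeff q n * x ^ n))"
    by (intro summable_mult summable_norm_theta)
  show "norm (norm (w n * (partial_theta_coeff q n * x ^ n)))
      \<le> K * norm (partial_theta_coeff q n * x ^ n)" for n
    using assms[of n] by (auto simp: norm_mult intro!: mult_right_mono)
qed

text \<open>
The terms of Euler's expansion of \<open>(x; q)\<^sub>\<infinity>\<close>; the five-fold series below is built from them.
\<close>

definition euler :: "complex \<Rightarrow> nat \<Rightarrow> complex" where
  "euler x n = partial_theta_coeff q n * x ^ n / qpoch q q n"

lemma euler_0 [simp]: "euler x 0 = 1"
  by (simp add: euler_def)

lemma euler_mult_power: "euler x n * y ^ n = euler (x * y) n"
  by (simp add: euler_def power_mult_distrib)

lemma summable_norm_euler: "summable (\<lambda>n. norm (euler x n))"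
proof -
  obtain K where "\<And>n. norm (inverse (qpoch q q n)) \<le> K"
    using inverse_qq_bounded by blast
  from summable_norm_weighted_theta[OF this, where x = x] show ?thesis
    by (simp add: euler_def field_simps)
qed

lemma summable_norm_qpoch_euler: "summable (\<lambda>n. norm (qpoch y q n * euler x n))"
proof -
  obtain K where K: "\<And>n. norm (inverse (qpoch q q n)) \<le> K"
    using inverse_qq_bounded by blast
  obtain L where L: "\<And>n. norm (qpoch y q n) \<le> L"
    using qpoch_bounded by blast
  have "norm (qpoch y q n * inverse (qpoch q q n)) \<le> L * K" for n
    unfolding norm_mult using K[of n] L[of n]
    by (intro mult_mono) (auto intro: order_trans[OF norm_ge_zero])
  from summable_norm_weighted_theta[OF this, where x = x] show ?thesis
    by (simp add: euler_def field_simps)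
qed

text \<open>
Since \<open>x q\<^sup>n \<longlonglongrightarrow> 0\<close>, a function that is continuous at 0 and known up to a factor under
\<open>x \<mapsto> x q\<^sup>n\<close> is determined by its value at 0.
\<close>

lemma value_at_0_of_q_dilation:
  fixes f :: "complex \<Rightarrow> complex"
  assumes "isCont f 0" and "\<And>n. f x = w n * f (x * q ^ n)" and "w \<longlonglongrightarrow> L"
  shows "f x = L * f 0"
proof -
  have "(\<lambda>n. x * q ^ n) \<longlonglongrightarrow> 0"
    using q_less_1 by (intro tendsto_mult_right_zero LIMSEQ_power_zero)
  then have "(\<lambda>n. f (x * q ^ n)) \<longlonglongrightarrow> f 0"
    by (rule isCont_tendsto_compose[OF assms(1)])
  then have "(\<lambda>n. w n * f (x * q ^ n)) \<longlonglongrightarrow> L * f 0"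
    by (intro tendsto_mult assms)
  then show ?thesis
    using assms(2) by (simp flip: assms(2) add: LIMSEQ_const_iff)
qed

text \<open>
Comparing coefficients, the power series \<open>f\<close> satisfies \<open>f(x) = (1 - x) f(x q)\<close>; iterating this
equation produces the infinite product.
\<close>

lemma euler_sums: "euler x sums qpoch_inf x q"
proof -
  define c where "c n = partial_theta_coeff q n / qpoch q q n" for n
  define f where "f x = (\<Sum>n. c n * x ^ n)" for x
  have e: "euler x n = c n * x ^ n" for x n
    by (simp add: euler_def c_def)
  have summ: "summable (\<lambda>n. c n * x ^ n)" for x
    using summable_norm_cancel[OF summable_norm_euler[of x]] unfolding e .
  have "isCont f 0"
    unfolding f_def by (rule isCont_powser[OF summ[of 1]]) simp
  have step: "f y = (1 - y) * f (y * q)" for y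
  proof -
    have s: "(\<lambda>n. c n * (y * q) ^ n) sums f (y * q)"
      unfolding f_def by (rule summable_sums[OF summ])
    have "(\<lambda>n. c n * (y * q) ^ n - y * (case n of 0 \<Rightarrow> 0 | Suc k \<Rightarrow> c k * (y * q) ^ k))
        sums (f (y * q) - y * f (y * q))"
      by (intro sums_diff sums_mult sums_case_nat_0 s)
    moreover have "c n * (y * q) ^ n - y * (case n of 0 \<Rightarrow> 0 | Suc k \<Rightarrow> c k * (y * q) ^ k) = c n * y ^ n" for n
    proof (cases n)
      case (Suc k)
      have *: "c (Suc k) * (1 - q ^ Suc k) = - (q ^ k) * c k"
        using power_neq_1[of "Suc k"] qq_nz[of k]
        by (simp add: c_def partial_theta_coeff_Suc qq_Suc del: power_Suc qq_nz)
      have "c (Suc k) * (y * q) ^ Suc k - y * (c k * (y * q) ^ k)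
          = y ^ Suc k * (c (Suc k) * q ^ Suc k - q ^ k * c k)"
        by (simp add: power_mult_distrib algebra_simps)
      also have "c (Suc k) * q ^ Suc k - q ^ k * c k = c (Suc k)"
        using * by (simp add: algebra_simps)
      finally show ?thesis by (simp add: Suc)
    qed simp
    ultimately have "(\<lambda>n. c n * y ^ n) sums (f (y * q) - y * f (y * q))"
      by simp
    then show ?thesis unfolding f_def by (simp add: sums_iff algebra_simps)
  qed
  have "f x = qpoch x q n * f (x * q ^ n)" for n
  proof (induction n)
    case (Suc n)
    then show ?case using step[of "x * q ^ n"] by (simp add: qpoch_Suc mult_ac)
  qed simp
  from value_at_0_of_q_dilation[OF \<open>isCont f 0\<close> this qpoch_LIMSEQ]
  have "f x = qpoch_inf x q * f 0" .
  also have "f 0 = 1" by (simp add: f_def) (simp add: c_def)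
  finally have "f x = qpoch_inf x q" by simp
  then show ?thesis
    using summable_sums[OF summ[of x]] unfolding e f_def by simp
qed

lemma summable_geometric_qq:
  assumes "norm x < 1"
  shows "summable (\<lambda>n. norm (x ^ n / qpoch q q n))"
proof -
  obtain K where K: "\<And>n. norm (inverse (qpoch q q n)) \<le> K"
    using inverse_qq_bounded by blast
  show ?thesis
  proof (rule summable_comparison_test')
    show "summable (\<lambda>n. norm x ^ n * K)"
      by (intro summable_mult2 summable_geometric) (use assms in auto)
    show "norm (norm (x ^ n / qpoch q q n)) \<le> norm x ^ n * K" for n
      using K[of n] by (auto simp: norm_mult norm_power divide_inverse intro!: mult_left_mono)
  qed
qed

text \<open>
Euler's second formula \<open>\<Sum>\<^sub>n x\<^sup>n / (q; q)\<^sub>n = 1 / (x; q)\<^sub>\<infinity>\<close>, multiplied out. Here the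
functional equation is \<open>(1 - x) f(x) = f(x q)\<close>.
\<close>

lemma geometric_qq_sums:
  assumes "norm x < 1"
  shows "(\<lambda>n. qpoch_inf x q * (x ^ n / qpoch q q n)) sums 1"
proof -
  define c where "c n = 1 / qpoch q q n" for n
  define f where "f x = (\<Sum>n. c n * x ^ n)" for x
  have summ: "summable (\<lambda>n. c n * x ^ n)" if "norm x < 1" for x
    using summable_norm_cancel[OF summable_geometric_qq[OF that]] by (simp add: c_def)
  have "isCont f 0"
    unfolding f_def by (rule isCont_powser[OF summ[of "1/2"]]) simp_all
  have step: "(1 - y) * f y = f (y * q)" if "norm y < 1" for y
  proof -
    have s: "(\<lambda>n. c n * y ^ n) sums f y"
      unfolding f_def by (rule summable_sums[OF summ[OF that]])
    have "(\<lambda>n. c n * y ^ n - y * (case n of 0 \<Rightarrow> 0 | Suc k \<Rightarrow> c k * y ^ k)) sums (f y - y * f y)"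
      by (intro sums_diff sums_mult sums_case_nat_0 s)
    moreover have "c n * y ^ n - y * (case n of 0 \<Rightarrow> 0 | Suc k \<Rightarrow> c k * y ^ k) = c n * (y * q) ^ n" for n
    proof (cases n)
      case (Suc k)
      have *: "c (Suc k) * (1 - q ^ Suc k) = c k"
        using power_neq_1[of "Suc k"] by (simp add: c_def qq_Suc del: power_Suc)
      show ?thesis unfolding Suc by (simp add: *[symmetric] power_mult_distrib algebra_simps)
    qed simp
    ultimately have "(\<lambda>n. c n * (y * q) ^ n) sums (f y - y * f y)"
      by simp
    then show ?thesis unfolding f_def by (simp add: sums_iff algebra_simps)
  qed
  have "norm (x * q ^ n) < 1" for n
  proof -
    have "norm x * norm q ^ n \<le> norm x * 1"
      using q_less_1 by (intro mult_left_mono power_le_one) auto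
    then show ?thesis using assms by (simp add: norm_mult norm_power)
  qed
  note norm_less = this
  have "f (x * q ^ n) = qpoch x q n * f x" for n
  proof (induction n)
    case (Suc n)
    then show ?case using step[OF norm_less[of n]] by (simp add: qpoch_Suc mult_ac)
  qed simp
  moreover have "(\<lambda>n. f (x * q ^ n)) \<longlonglongrightarrow> f 0"
    by (rule isCont_tendsto_compose[OF \<open>isCont f 0\<close>])
      (use q_less_1 in \<open>intro tendsto_mult_right_zero LIMSEQ_power_zero\<close>)
  ultimately have "(\<lambda>n. qpoch x q n * f x) \<longlonglongrightarrow> f 0"
    by simp
  moreover have "(\<lambda>n. qpoch x q n * f x) \<longlonglongrightarrow> qpoch_inf x q * f x"
    by (intro tendsto_intros qpoch_LIMSEQ)
  ultimately have "qpoch_inf x q * f x = f 0"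
    using LIMSEQ_unique by blast
  also have "f 0 = 1" by (simp add: f_def) (simp add: c_def)
  finally show ?thesis
    using sums_mult[OF summable_sums[OF summ[OF assms]], of "qpoch_inf x q"]
    by (simp add: f_def c_def)
qed

text \<open>
The special case \<open>x = q^(N+1)\<close>, where \<open>(q; q)\<^sub>\<infinity> = (q; q)\<^sub>N (x; q)\<^sub>\<infinity>\<close>. This is what makes the
summation over \<open>p\<close> in the five-fold series elementary.
\<close>

lemma qq_inf_geometric_sums:
  "(\<lambda>n. qpoch_inf q q * ((q ^ Suc N) ^ n / qpoch q q n)) sums qpoch q q N"
proof -
  have "norm (q ^ Suc N) < 1"
    using q_less_1 by (metis norm_power norm_ge_zero q_pos power_Suc_less_one)
  from sums_mult[OF geometric_qq_sums[OF this], of "qpoch q q N"]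
  show ?thesis by (simp add: qpoch_inf_split[of q N] mult_ac)
qed

section \<open>The finite q-binomial theorem and the coefficient identity\<close>

text \<open>
The value 0 for \<open>s > n\<close> makes both Pascal rules hold without side conditions and allows
sums to be extended freely.
\<close>

definition qbinom :: "nat \<Rightarrow> nat \<Rightarrow> complex" where
  "qbinom n s = (if s \<le> n then qpoch q q n / (qpoch q q s * qpoch q q (n - s)) else 0)"

lemma qbinom_0 [simp]: "qbinom n 0 = 1"
  by (simp add: qbinom_def)

lemma qbinom_self [simp]: "qbinom n n = 1"
  by (simp add: qbinom_def)

lemma qbinom_Suc_Suc: "qbinom (Suc n) (Suc s) = qbinom n (Suc s) + q ^ (n - s) * qbinom n s"
  and qbinom_Suc_Suc': "qbinom (Suc n) (Suc s) = q ^ Suc s * qbinom n (Suc s) + qbinom n s"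
proof -
  consider "n < s" | "s = n" | d where "n = s + Suc d"
    by (metis add_Suc_right less_imp_Suc_add linorder_neqE_nat)
  then have "qbinom (Suc n) (Suc s) = qbinom n (Suc s) + q ^ (n - s) * qbinom n s \<and>
    qbinom (Suc n) (Suc s) = q ^ Suc s * qbinom n (Suc s) + qbinom n s"
  proof cases
    case 3
    define Q S D where "Q = qpoch q q n" and "S = qpoch q q s" and "D = qpoch q q d"
    define y z where "y = q ^ Suc s" and "z = q ^ Suc d"
    have nz: "S \<noteq> 0" "D \<noteq> 0" "1 - y \<noteq> 0" "1 - z \<noteq> 0"
      using power_neq_1[of "Suc s"] power_neq_1[of "Suc d"]
      by (auto simp: S_def D_def y_def z_def simp del: power_Suc)
    have e: "q ^ Suc n = y * z" by (simp add: 3 y_def z_def power_add)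
    have "qbinom (Suc n) (Suc s) = qpoch q q (Suc n) / (qpoch q q (Suc s) * qpoch q q (Suc d))"
      using 3 by (simp add: qbinom_def)
    then have 1: "qbinom (Suc n) (Suc s) = Q * (1 - y * z) / (S * (1 - y) * (D * (1 - z)))"
      by (simp only: qq_Suc Q_def S_def D_def e y_def z_def)
    have 2: "qbinom n (Suc s) = Q / (S * (1 - y) * D)"
      using 3 by (simp add: qbinom_def qq_Suc Q_def S_def D_def y_def[symmetric] z_def[symmetric] del: power_Suc)
    have 4: "qbinom n s = Q / (S * (D * (1 - z)))" and 5: "q ^ (n - s) = z"
      using 3 by (simp_all add: qbinom_def qq_Suc Q_def S_def D_def y_def[symmetric] z_def del: power_Suc)
    show ?thesis
      unfolding 1 2 4 5 y_def[symmetric] using nz by (simp add: divide_simps) (simp add: algebra_simps)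
  qed (auto simp: qbinom_def)
  then show "qbinom (Suc n) (Suc s) = qbinom n (Suc s) + q ^ (n - s) * qbinom n s"
    and "qbinom (Suc n) (Suc s) = q ^ Suc s * qbinom n (Suc s) + qbinom n s"
    by auto
qed

definition qpoch_coeff :: "nat \<Rightarrow> nat \<Rightarrow> complex" where
  "qpoch_coeff n s = qbinom n s * partial_theta_coeff q s"

lemma qpoch_coeff_Suc_Suc:
  "qpoch_coeff (Suc n) (Suc s) = qpoch_coeff n (Suc s) - q ^ n * qpoch_coeff n s"
proof (cases "s \<le> n")
  case True
  then have "q ^ n = q ^ (n - s) * q ^ s" by (simp flip: power_add)
  then show ?thesis
    by (simp add: qpoch_coeff_def qbinom_Suc_Suc partial_theta_coeff_Suc algebra_simps)
qed (simp add: qpoch_coeff_def qbinom_def)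

lemma finite_qbinomial: "qpoch x q n = (\<Sum>s\<le>n. qpoch_coeff n s * x ^ s)"
proof (induction n)
  case (Suc n)
  have "(\<Sum>s\<le>Suc n. qpoch_coeff (Suc n) s * x ^ s)
      = 1 + (\<Sum>s\<le>n. qpoch_coeff n (Suc s) * x ^ Suc s) - q ^ n * x * (\<Sum>s\<le>n. qpoch_coeff n s * x ^ s)"
    by (simp add: sum.atMost_Suc_shift qpoch_coeff_Suc_Suc sum_subtractf sum_distrib_left algebra_simps
        del: sum.atMost_Suc) (simp add: qpoch_coeff_def)
  also have "1 + (\<Sum>s\<le>n. qpoch_coeff n (Suc s) * x ^ Suc s) = (\<Sum>s\<le>Suc n. qpoch_coeff n s * x ^ s)"
    by (simp add: sum.atMost_Suc_shift del: sum.atMost_Suc) (simp add: qpoch_coeff_def)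
  also have "\<dots> = (\<Sum>s\<le>n. qpoch_coeff n s * x ^ s)"
    by (simp add: qpoch_coeff_def qbinom_def)
  finally show ?case by (simp add: Suc qpoch_Suc algebra_simps)
qed (simp add: qpoch_coeff_def)

text \<open>
The symbol \<open>(c z; q)\<^sub>n\<close> with a formal variable \<open>z\<close>: it serves to
extract coefficients in a generating function over the exponent of \<open>a\<close>.
\<close>

definition fps_qpoch :: "complex \<Rightarrow> nat \<Rightarrow> complex fps" where
  "fps_qpoch c n = (\<Prod>i<n. 1 - fps_const (c * q ^ i) * fps_X)"

lemma fps_qpoch_0 [simp]: "fps_qpoch c 0 = 1"
  by (simp add: fps_qpoch_def)

lemma fps_qpoch_Suc: "fps_qpoch c (Suc n) = fps_qpoch c n * (1 - fps_const (c * q ^ n) * fps_X)"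
  by (simp add: fps_qpoch_def)

lemma fps_qpoch_add: "fps_qpoch c (m + n) = fps_qpoch c m * fps_qpoch (c * q ^ m) n"
  by (induction n) (simp_all add: fps_qpoch_Suc power_add mult_ac)

lemma fps_qpoch_nz: "fps_qpoch c n \<noteq> 0"
proof -
  have "fps_nth (fps_qpoch c n) 0 = 1"
    by (induction n) (simp_all add: fps_qpoch_Suc)
  then show ?thesis by auto
qed

lemma fps_nth_mult_linear:
  "fps_nth (F * (1 - fps_const c * fps_X)) (Suc n) = fps_nth F (Suc n) - c * fps_nth F n"
  for F :: "complex fps"
proof -
  have "F * (1 - fps_const c * fps_X) = F - fps_const c * (fps_X * F)"
    by (simp add: algebra_simps)
  then show ?thesis by simp
qed

lemma fps_nth_qpoch: "fps_nth (fps_qpoch c n) s = qpoch_coeff n s * c ^ s"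
proof (induction n arbitrary: s)
  case 0
  then show ?case by (cases s) (auto simp: qpoch_coeff_def qbinom_def)
next
  case (Suc n)
  show ?case
  proof (cases s)
    case 0
    then show ?thesis using Suc[of 0] by (simp add: fps_qpoch_Suc qpoch_coeff_def)
  next
    case (Suc r)
    then show ?thesis
      by (simp add: fps_qpoch_Suc fps_nth_mult_linear Suc.IH qpoch_coeff_Suc_Suc algebra_simps)
  qed
qed

text \<open>
The expansion of \<open>1 / (c z; q)_(u+1)\<close>.
\<close>

definition fps_inv_qpoch :: "complex \<Rightarrow> nat \<Rightarrow> complex fps" where
  "fps_inv_qpoch c u = Abs_fps (\<lambda>i. qbinom (i + u) u * c ^ i)"

lemma fps_inv_qpoch_mult: "fps_inv_qpoch c u * fps_qpoch c (Suc u) = 1"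
proof (induction u)
  case 0
  have "fps_inv_qpoch c 0 * (1 - fps_const c * fps_X) = 1"
  proof (rule fps_ext)
    show "fps_nth (fps_inv_qpoch c 0 * (1 - fps_const c * fps_X)) n = fps_nth 1 n" for n
      by (cases n) (simp_all add: fps_nth_mult_linear, simp_all add: fps_inv_qpoch_def)
  qed
  then show ?case by (simp add: fps_qpoch_Suc)
next
  case (Suc u)
  have "fps_inv_qpoch c (Suc u) * (1 - fps_const (c * q ^ Suc u) * fps_X) = fps_inv_qpoch c u"
  proof (rule fps_ext)
    fix n
    show "fps_nth (fps_inv_qpoch c (Suc u) * (1 - fps_const (c * q ^ Suc u) * fps_X)) n
      = fps_nth (fps_inv_qpoch c u) n"
    proof (cases n)
      case (Suc i)
      show ?thesis using qbinom_Suc_Suc'[of "Suc (i + u)" u]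
        by (simp add: Suc fps_nth_mult_linear del: power_Suc)
           (simp add: fps_inv_qpoch_def algebra_simps)
    qed (simp add: fps_inv_qpoch_def)
  qed
  moreover have "fps_inv_qpoch c (Suc u) * fps_qpoch c (Suc (Suc u))
      = fps_inv_qpoch c (Suc u) * (1 - fps_const (c * q ^ Suc u) * fps_X) * fps_qpoch c (Suc u)"
    unfolding fps_qpoch_Suc[of c "Suc u"] by (simp only: mult_ac)
  ultimately show ?case using Suc by simp
qed

text \<open>
After division by \<open>(z \<alpha> q; q)\<^sub>l\<close> this says
\<open>\<Sum>k\<le>l. (\<alpha>, z; q)\<^sub>k / (q, \<alpha> z q; q)\<^sub>k q\<^sup>k = (\<alpha> q, z q; q)\<^sub>l / (q, \<alpha> z q; q)\<^sub>l\<close>.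
The denominator parameter \<open>\<alpha> z q\<close> is the one for which a truncated \<open>2\<phi>1\<close> series at
\<open>q\<close> has a closed form, so the induction on \<open>l\<close> closes. Multiplied out, both sides are polynomials in \<open>z\<close>.
\<close>

lemma fps_partial_2phi1_sum:
  "(\<Sum>k\<le>l. fps_const (qpoch \<alpha> q k / qpoch q q k * q ^ k) * fps_qpoch (\<alpha> * q ^ Suc k) (l - k) * fps_qpoch 1 k)
     = fps_const (qpoch (\<alpha> * q) q l / qpoch q q l) * fps_qpoch q l"
proof (induction l)
  case (Suc l)
  define E A E' Q where "E = qpoch (\<alpha> * q) q l / qpoch q q l"
    and "A = qpoch \<alpha> q (Suc l) / qpoch q q (Suc l) * q ^ Suc l"
    and "E' = qpoch (\<alpha> * q) q (Suc l) / qpoch q q (Suc l)" and "Q = q ^ Suc l"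
  have Q: "1 - Q \<noteq> 0" using power_neq_1[of "Suc l"] by (simp add: Q_def)
  have A: "A = E * (1 - \<alpha>) * Q / (1 - Q)"
    unfolding A_def E_def qpoch_Suc_shift[of \<alpha>] qq_Suc Q_def by simp
  have E': "E' = E * (1 - \<alpha> * Q) / (1 - Q)"
    unfolding E'_def E_def qpoch_Suc[of "\<alpha> * q"] qq_Suc Q_def by (simp add: mult_ac)
  \<comment> \<open>the coefficients of \<open>1\<close> and \<open>z\<close> in the induction step, after removal of the factor \<open>(z q; q)\<^sub>l\<close>\<close>
  have coeffs: "E + A = E'" "E * (\<alpha> * Q) + A = E' * Q"
    unfolding A E' using Q by (simp_all add: divide_simps) (simp_all add: algebra_simps)
  have "(\<Sum>k\<le>Suc l. fps_const (qpoch \<alpha> q k / qpoch q q k * q ^ k) * fps_qpoch (\<alpha> * q ^ Suc k) (Suc l - k) * fps_qpoch 1 k)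
     = (\<Sum>k\<le>l. fps_const (qpoch \<alpha> q k / qpoch q q k * q ^ k) * fps_qpoch (\<alpha> * q ^ Suc k) (Suc l - k) * fps_qpoch 1 k)
       + fps_const A * fps_qpoch 1 (Suc l)"
    by (simp add: A_def)
  also have "(\<Sum>k\<le>l. fps_const (qpoch \<alpha> q k / qpoch q q k * q ^ k) * fps_qpoch (\<alpha> * q ^ Suc k) (Suc l - k) * fps_qpoch 1 k)
     = (\<Sum>k\<le>l. fps_const (qpoch \<alpha> q k / qpoch q q k * q ^ k) * fps_qpoch (\<alpha> * q ^ Suc k) (l - k) * fps_qpoch 1 k)
        * (1 - fps_const (\<alpha> * Q) * fps_X)"
    unfolding sum_distrib_right
  proof (rule sum.cong[OF refl])
    fix k assume "k \<in> {..l}"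
    then have "Suc l - k = Suc (l - k)" "\<alpha> * q ^ Suc k * q ^ (l - k) = \<alpha> * Q"
      by (auto simp: Q_def simp flip: power_add)
    then have *: "fps_qpoch (\<alpha> * q ^ Suc k) (Suc l - k)
        = fps_qpoch (\<alpha> * q ^ Suc k) (l - k) * (1 - fps_const (\<alpha> * Q) * fps_X)"
      by (simp only: fps_qpoch_Suc)
    show "fps_const (qpoch \<alpha> q k / qpoch q q k * q ^ k) * fps_qpoch (\<alpha> * q ^ Suc k) (Suc l - k) * fps_qpoch 1 k
      = fps_const (qpoch \<alpha> q k / qpoch q q k * q ^ k) * fps_qpoch (\<alpha> * q ^ Suc k) (l - k) * fps_qpoch 1 k
         * (1 - fps_const (\<alpha> * Q) * fps_X)"
      unfolding * by (simp only: mult_ac)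
  qed
  also have "\<dots> = fps_const E * fps_qpoch q l * (1 - fps_const (\<alpha> * Q) * fps_X)"
    unfolding Suc.IH E_def ..
  also have "fps_qpoch 1 (Suc l) = (1 - fps_X) * fps_qpoch q l"
    using fps_qpoch_add[of 1 "Suc 0" l] by (simp add: fps_qpoch_Suc)
  also have "fps_const E * fps_qpoch q l * (1 - fps_const (\<alpha> * Q) * fps_X) + fps_const A * ((1 - fps_X) * fps_qpoch q l)
     = (fps_const (E + A) - fps_const (E * (\<alpha> * Q) + A) * fps_X) * fps_qpoch q l"
    by (simp add: algebra_simps flip: fps_const_add fps_const_mult)
  also have "\<dots> = fps_const E' * fps_qpoch q (Suc l)"
    unfolding coeffs by (simp add: fps_qpoch_Suc Q_def algebra_simps flip: fps_const_mult)
  finally show ?case unfolding E'_def .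
qed simp

text \<open>
The right-hand side is free of \<open>i\<close>. To see why, multiply by \<open>z\<^sup>i\<close> and sum over \<open>i\<close>: the
inner sum over \<open>s\<close> is a Cauchy product and gives
\<open>(\<alpha> z q^(k+1); q)_(l-k) / (z q\<^sup>k; q)_(l-k+1)\<close>. Multiplication by \<open>(z; q)_(l+1)\<close> leads to the sum in
\<open>fps_partial_2phi1_sum\<close>, and the result is the constant on the right times \<open>1 / (1 - z)\<close>.
\<close>

lemma theta_coefficient_identity:
  "(\<Sum>k\<le>l. qpoch \<alpha> q k / qpoch q q k * q ^ k * q ^ (k * i) *
      (\<Sum>s\<le>i. qpoch_coeff (l - k) s * (\<alpha> * q) ^ s * qbinom (i - s + (l - k)) (l - k)))
    = qpoch (\<alpha> * q) q l / qpoch q q l"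
proof -
  define A where "A k = fps_const (qpoch \<alpha> q k / qpoch q q k * q ^ k)" for k
  define F where "F = (\<Sum>k\<le>l. A k * (fps_qpoch (\<alpha> * q ^ Suc k) (l - k) * fps_inv_qpoch (q ^ k) (l - k)))"
  define E where "E = fps_const (qpoch (\<alpha> * q) q l / qpoch q q l)"
  \<comment> \<open>clearing denominators by \<open>(z; q)_(l+1) = (z; q)\<^sub>k (z q\<^sup>k; q)_(l-k+1)\<close>\<close>
  have "F * fps_qpoch 1 (Suc l) = (\<Sum>k\<le>l. A k * fps_qpoch (\<alpha> * q ^ Suc k) (l - k) * fps_qpoch 1 k)"
    unfolding F_def sum_distrib_right
  proof (rule sum.cong[OF refl])
    fix k assume "k \<in> {..l}"
    then have "fps_qpoch 1 (Suc l) = fps_qpoch 1 k * fps_qpoch (q ^ k) (Suc (l - k))"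
      using fps_qpoch_add[of 1 k "Suc (l - k)"] by simp
    then have "A k * (fps_qpoch (\<alpha> * q ^ Suc k) (l - k) * fps_inv_qpoch (q ^ k) (l - k)) * fps_qpoch 1 (Suc l)
       = A k * fps_qpoch (\<alpha> * q ^ Suc k) (l - k) * fps_qpoch 1 k
         * (fps_inv_qpoch (q ^ k) (l - k) * fps_qpoch (q ^ k) (Suc (l - k)))"
      by (simp only: mult_ac)
    then show "A k * (fps_qpoch (\<alpha> * q ^ Suc k) (l - k) * fps_inv_qpoch (q ^ k) (l - k)) * fps_qpoch 1 (Suc l)
       = A k * fps_qpoch (\<alpha> * q ^ Suc k) (l - k) * fps_qpoch 1 k"
      unfolding fps_inv_qpoch_mult by simp
  qed
  also have "\<dots> = E * fps_qpoch q l"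
    unfolding A_def E_def by (rule fps_partial_2phi1_sum)
  \<comment> \<open>that is, \<open>(z q; q)\<^sub>l = (z; q)_(l+1) / (1 - z)\<close>\<close>
  also have "fps_qpoch q l = fps_inv_qpoch 1 0 * fps_qpoch 1 (Suc l)"
    using fps_inv_qpoch_mult[of 1 0] fps_qpoch_add[of 1 "Suc 0" l]
    by (simp add: mult.assoc[symmetric])
  finally have "F = E * fps_inv_qpoch 1 0"
    using fps_qpoch_nz[of 1 "Suc l"] by (simp add: mult.assoc[symmetric])
  then have "fps_nth F i = fps_nth (E * fps_inv_qpoch 1 0) i" by simp
  also have "\<dots> = qpoch (\<alpha> * q) q l / qpoch q q l"
    by (simp add: E_def fps_inv_qpoch_def)
  also have "fps_nth F i = (\<Sum>k\<le>l. qpoch \<alpha> q k / qpoch q q k * q ^ k * q ^ (k * i) *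
      (\<Sum>s\<le>i. qpoch_coeff (l - k) s * (\<alpha> * q) ^ s * qbinom (i - s + (l - k)) (l - k)))"
    unfolding F_def fps_sum_nth A_def fps_mult_left_const_nth
  proof (rule sum.cong[OF refl])
    fix k assume "k \<in> {..l}"
    have "fps_nth (fps_qpoch (\<alpha> * q ^ Suc k) (l - k) * fps_inv_qpoch (q ^ k) (l - k)) i
       = (\<Sum>s\<le>i. q ^ (k * i) * (qpoch_coeff (l - k) s * (\<alpha> * q) ^ s * qbinom (i - s + (l - k)) (l - k)))"
      unfolding fps_mult_nth atLeast0AtMost
    proof (rule sum.cong[OF refl])
      fix s assume "s \<in> {..i}"
      then have "k * i = k * s + k * (i - s)" by (simp flip: add_mult_distrib2)
      then have "q ^ (k * i) = (q ^ k) ^ s * (q ^ k) ^ (i - s)"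
        by (simp flip: power_add power_mult)
      then show "fps_nth (fps_qpoch (\<alpha> * q ^ Suc k) (l - k)) s * fps_nth (fps_inv_qpoch (q ^ k) (l - k)) (i - s)
         = q ^ (k * i) * (qpoch_coeff (l - k) s * (\<alpha> * q) ^ s * qbinom (i - s + (l - k)) (l - k))"
        by (simp add: fps_nth_qpoch fps_inv_qpoch_def power_mult_distrib)
    qed
    then show "qpoch \<alpha> q k / qpoch q q k * q ^ k * fps_nth (fps_qpoch (\<alpha> * q ^ Suc k) (l - k) * fps_inv_qpoch (q ^ k) (l - k)) i
      = qpoch \<alpha> q k / qpoch q q k * q ^ k * q ^ (k * i) *
      (\<Sum>s\<le>i. qpoch_coeff (l - k) s * (\<alpha> * q) ^ s * qbinom (i - s + (l - k)) (l - k))"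
      by (simp add: sum_distrib_left mult_ac)
  qed
  finally show ?thesis .
qed

section \<open>Two summations of one five-fold series\<close>

lemma norm_summable_on:
  fixes f :: "nat \<Rightarrow> complex"
  assumes "summable (\<lambda>n. norm (f n))"
  shows "(\<lambda>n. norm (f n)) summable_on UNIV"
  using assms by (simp add: summable_on_UNIV_nonneg_real_iff)

lemma partial_theta_coeff_square:
  "partial_theta_coeff q s * partial_theta_coeff q s * q ^ s = q ^ (s * s)"
proof (induction s)
  case (Suc s)
  have "partial_theta_coeff q (Suc s) * partial_theta_coeff q (Suc s) * q ^ Suc s
      = (partial_theta_coeff q s * partial_theta_coeff q s * q ^ s) * (q ^ s * q ^ s * q)"
    by (simp add: partial_theta_coeff_Suc mult_ac)
  also have "\<dots> = q ^ (s * s + (s + s + 1))"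
    unfolding Suc.IH by (simp add: power_add)
  also have "s * s + (s + s + 1) = Suc s * Suc s"
    by simp
  finally show ?case .
qed simp

text \<open>
The general term of the fully expanded series. All dependence on
\<open>n = k + s + p\<close> beyond the five separate factors is in the last power of \<open>q\<close>. The factor
\<open>q\<^sup>n\<close> of the original series has been combined with the powers \<open>(q^(n-1+k))\<^sup>s\<close>, so that no negative exponent is left.
\<close>

definition five_term :: "complex \<Rightarrow> complex \<Rightarrow> complex \<Rightarrow> nat \<Rightarrow> nat \<Rightarrow> nat \<Rightarrow> nat \<Rightarrow> nat \<Rightarrow> complex" where
  "five_term \<alpha> a c k s p r t =
     qpoch_inf q q * (qpoch \<alpha> q k * euler c k) * euler (a * c * \<alpha>) s * (q ^ p / qpoch q q p)
       * (euler a r * euler c t) * q ^ (k + (k + s + p) * (r + t) + (2 * k + s + p) * s)"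

text \<open>
The last power of \<open>q\<close> has norm at most 1; without it the term is a product of five
absolutely summable sequences, one in each index.
\<close>

lemma five_term_summable:
  "(\<lambda>((k, s, p), (r, t)). five_term \<alpha> a c k s p r t) summable_on UNIV"
proof (rule abs_summable_summable, rule Infinite_Sum.abs_summable_on_comparison_test')
  let ?g = "\<lambda>((k, s, p), (r, t)). norm
    (((qpoch \<alpha> q k * euler c k) * (euler (a * c * \<alpha>) s * (q ^ p / qpoch q q p))) * (euler a r * euler c t))"
  have "?g summable_on ((UNIV \<times> (UNIV \<times> UNIV)) \<times> (UNIV \<times> UNIV))"
    using abs_summable_on_times[OF
        abs_summable_on_times[OF norm_summable_on[OF summable_norm_qpoch_euler[of \<alpha> c]]
          abs_summable_on_times[OF norm_summable_on[OF summable_norm_euler[of "a * c * \<alpha>"]]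
            norm_summable_on[OF summable_geometric_qq[OF q_less_1]], unfolded case_prod_unfold],
          unfolded case_prod_unfold]
        abs_summable_on_times[OF norm_summable_on[OF summable_norm_euler[of a]]
          norm_summable_on[OF summable_norm_euler[of c]], unfolded case_prod_unfold]]
    by (simp add: case_prod_unfold)
  then show "(\<lambda>x. norm (qpoch_inf q q) * ?g x) summable_on UNIV"
    by (intro summable_on_cmult_right) simp
  show "norm (case x of (xa, xb) \<Rightarrow> (case xa of (k, s, p) \<Rightarrow> \<lambda>(r, t). five_term \<alpha> a c k s p r t) xb)
     \<le> norm (qpoch_inf q q) * ?g x" for x
  proof -
    obtain k s p r t where x: "x = ((k, s, p), (r, t))" by (metis surj_pair)
    let ?w = "qpoch_inf q q * (((qpoch \<alpha> q k * euler c k) * (euler (a * c * \<alpha>) s * (q ^ p / qpoch q q p))) * (euler a r * euler c t))"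
    have "five_term \<alpha> a c k s p r t = ?w * q ^ (k + (k + s + p) * (r + t) + (2 * k + s + p) * s)"
      by (simp add: five_term_def mult_ac)
    then have "norm (five_term \<alpha> a c k s p r t) = norm ?w * norm q ^ (k + (k + s + p) * (r + t) + (2 * k + s + p) * s)"
      by (simp only: norm_mult norm_power)
    also have "\<dots> \<le> norm ?w * 1"
      using q_less_1 by (intro mult_left_mono power_le_one) auto
    finally show ?thesis by (simp only: x split norm_mult)
  qed
qed

text \<open>
The finite q-binomial theorem in the shape in which it occurs for fixed \<open>k\<close> and \<open>s + p = j\<close>. The
hypothesis is the equation \<open>Y = z q^(2k+j-1)\<close>, free of a negative exponent.
\<close>

lemma qpoch_weighted_sum:
  assumes "Y * q = z * q ^ (2 * k + j)"
  shows "(\<Sum>s\<le>j. euler z s * (q ^ (j - s) / qpoch q q (j - s)) * q ^ (k + (2 * k + j) * s))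
    = q ^ (k + j) * (qpoch Y q j / qpoch q q j)"
proof -
  have "euler z s * (q ^ (j - s) / qpoch q q (j - s)) * q ^ (k + (2 * k + j) * s)
      = q ^ (k + j) * (qpoch_coeff j s * Y ^ s / qpoch q q j)" if "s \<le> j" for s
  proof -
    have 1: "z ^ s * q ^ ((2 * k + j) * s) = Y ^ s * q ^ s"
      unfolding power_mult power_mult_distrib[symmetric] assms ..
    have 2: "q ^ (k + j) = q ^ k * q ^ (j - s) * q ^ s"
      using that by (simp flip: power_add)
    have "euler z s * (q ^ (j - s) / qpoch q q (j - s)) * q ^ (k + (2 * k + j) * s)
       = partial_theta_coeff q s / qpoch q q s * (q ^ (j - s) / qpoch q q (j - s)) * q ^ k
           * (z ^ s * q ^ ((2 * k + j) * s))"
      unfolding euler_def power_add[of q k] by simp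
    also have "\<dots> = q ^ k * q ^ (j - s) * q ^ s * (partial_theta_coeff q s / (qpoch q q s * qpoch q q (j - s)) * Y ^ s)"
      unfolding 1 by simp
    also have "\<dots> = q ^ (k + j) * (qpoch_coeff j s * Y ^ s / qpoch q q j)"
      using that unfolding 2 by (simp add: qpoch_coeff_def qbinom_def)
    finally show ?thesis .
  qed
  then show ?thesis
    by (simp add: finite_qbinomial[of Y] sum_divide_distrib sum_distrib_left)
qed

text \<open>
For \<open>\<alpha> = q^(-m)\<close> and \<open>c = b q\<^sup>m\<close> this is the \<open>n\<close>-th term of the right-hand side of the product
formula, the prefactor \<open>(q, a, b; q)\<^sub>\<infinity>\<close> included.
\<close>

definition n_term :: "complex \<Rightarrow> complex \<Rightarrow> complex \<Rightarrow> nat \<Rightarrow> complex" where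
  "n_term \<alpha> a c n = qpoch_inf q q * qpoch_inf (a * q ^ n) q * qpoch_inf (c * q ^ n) q * q ^ n *
     (\<Sum>k\<le>n. qpoch \<alpha> q k * euler c k *
        (qpoch (a * c * \<alpha> * q powi (int n - 1) * q ^ k) q (n - k) / qpoch q q (n - k)))"

lemma euler_product_has_sum:
  "((\<lambda>(r, t). euler x r * euler y t) has_sum qpoch_inf x q * qpoch_inf y q) UNIV"
  using has_sum_times[OF norm_summable_on[OF summable_norm_euler] norm_summable_on[OF summable_norm_euler]
     norm_summable_imp_has_sum[OF summable_norm_euler euler_sums] norm_summable_imp_has_sum[OF summable_norm_euler euler_sums]]
  by simp

text \<open>
For fixed \<open>(k, s, p)\<close> the sum over \<open>(r, t)\<close> restores the two infinite products; afterwards the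
finitely many triples with \<open>k + s + p = n\<close> are collected.
\<close>

lemma five_term_sum_by_n:
  assumes "((\<lambda>((k, s, p), (r, t)). five_term \<alpha> a c k s p r t) has_sum S) UNIV"
  shows "(n_term \<alpha> a c has_sum S) UNIV"
proof -
  define z where "z = a * c * \<alpha>"
  define P where "P n = qpoch_inf q q * (qpoch_inf (a * q ^ n) q * qpoch_inf (c * q ^ n) q)" for n
  define h where "h k s p = P (k + s + p) * ((qpoch \<alpha> q k * euler c k) *
      (euler z s * (q ^ p / qpoch q q p) * q ^ (k + (2 * k + s + p) * s)))" for k s p
  have inner: "((\<lambda>(r, t). five_term \<alpha> a c k s p r t) has_sum h k s p) UNIV" for k s p
  proof -
    define n where "n = k + s + p"
    define w where "w = qpoch_inf q q * (qpoch \<alpha> q k * euler c k) *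
      (euler z s * (q ^ p / qpoch q q p) * q ^ (k + (2 * k + s + p) * s))"
    have "five_term \<alpha> a c k s p r t = w * (euler (a * q ^ n) r * euler (c * q ^ n) t)" for r t
      unfolding five_term_def w_def z_def n_def[symmetric]
      by (simp only: power_add add_mult_distrib2 power_mult flip: euler_mult_power) (simp add: mult_ac)
    moreover have "h k s p = w * (qpoch_inf (a * q ^ n) q * qpoch_inf (c * q ^ n) q)"
      by (simp add: h_def P_def w_def n_def)
    ultimately show ?thesis
      using has_sum_cmult_right[OF euler_product_has_sum, of w "a * q ^ n" "c * q ^ n"]
      by (simp add: case_prod_unfold)
  qed
  have "((\<lambda>(k, s, p). h k s p) has_sum S) UNIV"
    by (rule has_sum_SigmaD[where B = "\<lambda>_. UNIV"]) (use assms inner in auto)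
  then show ?thesis
  proof (rule has_sum_fibres[where g = "\<lambda>(k, s, p). k + s + p"])
    fix n
    have "(\<Sum>x\<in>{x. (case x of (k, s, p) \<Rightarrow> k + s + p) = n}. case x of (k, s, p) \<Rightarrow> h k s p)
       = (\<Sum>(k, s)\<in>(SIGMA k:{..n}. {..n - k}). h k s (n - k - s))"
      by (rule sum.reindex_bij_witness[where i = "\<lambda>(k, s). (k, s, n - k - s)" and j = "\<lambda>(k, s, p). (k, s)"]) auto
    also have "\<dots> = (\<Sum>k\<le>n. \<Sum>s\<le>n - k. h k s (n - k - s))"
      by (simp add: sum.Sigma)
    also have "\<dots> = (\<Sum>k\<le>n. P n * q ^ n * (qpoch \<alpha> q k * euler c k *
        (qpoch (a * c * \<alpha> * q powi (int n - 1) * q ^ k) q (n - k) / qpoch q q (n - k))))"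
    proof (rule sum.cong[OF refl])
      fix k assume k: "k \<in> {..n}"
      define j where "j = n - k"
      have n: "n = k + j" using k by (simp add: j_def)
      have "q powi (int n - 1) * q = q ^ n"
        using q_nz by (simp add: power_int_diff)
      then have "a * c * \<alpha> * q powi (int n - 1) * q ^ k * q = z * (q ^ n * q ^ k)"
        by (simp add: z_def mult_ac)
      also have "q ^ n * q ^ k = q ^ (2 * k + j)"
        by (simp add: n mult_2 add_ac flip: power_add)
      finally have Y: "a * c * \<alpha> * q powi (int n - 1) * q ^ k * q = z * q ^ (2 * k + j)" .
      have "(\<Sum>s\<le>n - k. h k s (n - k - s)) = (\<Sum>s\<le>j. P n * (qpoch \<alpha> q k * euler c k) *
          (euler z s * (q ^ (j - s) / qpoch q q (j - s)) * q ^ (k + (2 * k + j) * s)))"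
        unfolding j_def[symmetric] by (rule sum.cong[OF refl]) (auto simp: h_def n)
      also have "\<dots> = P n * (qpoch \<alpha> q k * euler c k) *
         (q ^ (k + j) * (qpoch (a * c * \<alpha> * q powi (int n - 1) * q ^ k) q j / qpoch q q j))"
        by (simp only: qpoch_weighted_sum[OF Y] flip: sum_distrib_left)
      finally show "(\<Sum>s\<le>n - k. h k s (n - k - s)) = P n * q ^ n * (qpoch \<alpha> q k * euler c k *
        (qpoch (a * c * \<alpha> * q powi (int n - 1) * q ^ k) q (n - k) / qpoch q q (n - k)))"
        unfolding n[symmetric] unfolding j_def by (simp only: mult_ac)
    qed
    also have "\<dots> = n_term \<alpha> a c n"
      by (simp only: n_term_def P_def flip: sum_distrib_left) (simp only: mult_ac)
    finally have eq: "(\<Sum>x\<in>{x. (case x of (k, s, p) \<Rightarrow> k + s + p) = n}. case x of (k, s, p) \<Rightarrow> h k s p)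
      = n_term \<alpha> a c n" .
    have "finite {x. (case x of (k, s, p) \<Rightarrow> k + s + p) = n}"
      by (rule finite_subset[of _ "{..n} \<times> {..n} \<times> {..n}"]) auto
    then show "((\<lambda>(k, s, p). h k s p) has_sum n_term \<alpha> a c n) {x. (case x of (k, s, p) \<Rightarrow> k + s + p) = n}"
      by (rule has_sum_finiteI) (use eq in simp)
  qed
qed

text \<open>
The term left after the summation over \<open>p\<close>, written in terms of \<open>i = r + s\<close> and \<open>l = k + t + s\<close>.
The quadratic exponents match because \<open>\<tau>(x + y) = \<tau>(x) \<tau>(y) q^(x * y)\<close> and \<open>\<tau>(s)\<^sup>2 q\<^sup>s = q^(s * s)\<close>.
\<close>

lemma four_term_eq:
  "(qpoch \<alpha> q k * euler c k) * euler (a * c * \<alpha>) s * (euler a r * euler c t)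
      * q ^ (k + (k + s) * (r + t) + (2 * k + s) * s) * qpoch q q (r + s + t)
   = partial_theta_coeff q (r + s) * a ^ (r + s) * (partial_theta_coeff q (k + (t + s)) * c ^ (k + (t + s))) *
      (qpoch \<alpha> q k / qpoch q q k * q ^ k * q ^ (k * (r + s)) *
        (qpoch_coeff (t + s) s * (\<alpha> * q) ^ s * qbinom (r + (t + s)) (t + s)))"
proof -
  have "k + (k + s) * (r + t) + (2 * k + s) * s = r * s + (t * s + k * (t + s)) + k + k * (r + s) + s * s"
    by (simp add: algebra_simps)
  then have "q ^ (k + (k + s) * (r + t) + (2 * k + s) * s) = q ^ (r * s) * (q ^ (t * s) * q ^ (k * (t + s))) * q ^ k * q ^ (k * (r + s)) * q ^ (s * s)"
    by (simp only: power_add)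
  also have "q ^ (s * s) = partial_theta_coeff q s * partial_theta_coeff q s * q ^ s"
    by (rule partial_theta_coeff_square[symmetric])
  finally have E: "q ^ (k + (k + s) * (r + t) + (2 * k + s) * s) = q ^ (r * s) * (q ^ (t * s) * q ^ (k * (t + s))) * q ^ k
      * q ^ (k * (r + s)) * (partial_theta_coeff q s * partial_theta_coeff q s * q ^ s)" .
  have rst: "r + s + t = r + (t + s)" by simp
  show ?thesis
    unfolding E rst partial_theta_coeff_add euler_def qpoch_coeff_def qbinom_def
    by (simp add: power_add power_mult_distrib) (simp only: mult_ac)
qed

text \<open>
Here \<open>p\<close> is summed first, by Euler's second formula; the remaining terms are collected by the powers
of \<open>a\<close> and \<open>c\<close>, and \<open>theta_coefficient_identity\<close> evaluates each coefficient.
\<close>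

lemma five_term_product:
  assumes "((\<lambda>((k, s, p), (r, t)). five_term \<alpha> a c k s p r t) has_sum S) UNIV"
  shows "((\<lambda>(i, l). partial_theta_coeff q i * a ^ i * (qpoch (\<alpha> * q) q l * euler c l)) has_sum S) UNIV"
proof -
  define X where "X k s r t = (qpoch \<alpha> q k * euler c k) * euler (a * c * \<alpha>) s * (euler a r * euler c t)
      * q ^ (k + (k + s) * (r + t) + (2 * k + s) * s)" for k s r t
  have "((\<lambda>((k, s, r, t), p). five_term \<alpha> a c k s p r t) has_sum S) UNIV"
    using assms
    by (subst has_sum_reindex_bij_witness[where j = "\<lambda>((k, s, r, t), p). ((k, s, p), (r, t))"
          and i = "\<lambda>((k, s, p), (r, t)). ((k, s, r, t), p)" and T = UNIV and s' = S
          and h = "\<lambda>((k, s, p), (r, t)). five_term \<alpha> a c k s p r t"]) auto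
  then have outer: "((\<lambda>((k, s, r, t), p). five_term \<alpha> a c k s p r t) has_sum S) (UNIV \<times> UNIV)"
    by simp
  have inner: "((\<lambda>p. five_term \<alpha> a c k s p r t) has_sum X k s r t * qpoch q q (r + s + t)) UNIV" for k s r t
  proof -
    let ?x = "q ^ Suc (r + s + t)"
    have "norm ?x < 1"
      using q_less_1 by (metis norm_power norm_ge_zero q_pos power_Suc_less_one)
    then have "summable (\<lambda>p. norm (qpoch_inf q q * (?x ^ p / qpoch q q p)))"
      unfolding norm_mult[of "qpoch_inf q q"] by (intro summable_mult summable_geometric_qq)
    from norm_summable_imp_has_sum[OF this qq_inf_geometric_sums]
    have "((\<lambda>p. X k s r t * (qpoch_inf q q * (?x ^ p / qpoch q q p))) has_sum X k s r t * qpoch q q (r + s + t)) UNIV"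
      by (rule has_sum_cmult_right)
    moreover have "X k s r t * (qpoch_inf q q * (?x ^ p / qpoch q q p)) = five_term \<alpha> a c k s p r t" for p
    proof -
      have "q ^ p * q ^ (k + (k + s + p) * (r + t) + (2 * k + s + p) * s)
         = ?x ^ p * q ^ (k + (k + s) * (r + t) + (2 * k + s) * s)"
        unfolding power_mult[symmetric] power_add[symmetric] by (simp add: algebra_simps del: power_Suc)
      then show ?thesis
        unfolding X_def five_term_def by (simp add: mult_ac)
    qed
    ultimately show ?thesis by simp
  qed
  have "((\<lambda>(k, s, r, t). X k s r t * qpoch q q (r + s + t)) has_sum S) UNIV"
    by (rule has_sum_SigmaD[OF outer]) (use inner in auto)
  then show ?thesis
  proof (rule has_sum_fibres[where g = "\<lambda>(k, s, r, t). (r + s, k + (t + s))"], safe)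
    fix i l
    define D where "D = partial_theta_coeff q i * a ^ i * (partial_theta_coeff q l * c ^ l)"
    define y where "y k s = qpoch_coeff (l - k) s * (\<alpha> * q) ^ s * qbinom (i - s + (l - k)) (l - k)" for k s
    define x where "x k = qpoch \<alpha> q k / qpoch q q k * q ^ k * q ^ (k * i)" for k
    define f where "f = (\<lambda>(k, s, r, t). X k s r t * qpoch q q (r + s + t))"
    define B where "B = {x. (case x of (k, s, r, t) \<Rightarrow> (r + s, k + (t + s))) = (i, l)}"
    have "sum f B = (\<Sum>(k, s)\<in>(SIGMA k:{..l}. {..min i (l - k)}). D * (x k * y k s))"
    proof (rule sum.reindex_bij_witness[where j = "\<lambda>(k, s, r, t). (k, s)"
          and i = "\<lambda>(k, s). (k, s, i - s, l - k - s)"])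
      fix b assume "b \<in> B"
      then obtain k s r t where b: "b = (k, s, r, t)" "i = r + s" "l = k + (t + s)"
        unfolding B_def by (cases b) auto
      show "(case case b of (k, s, r, t) \<Rightarrow> (k, s) of (k, s) \<Rightarrow> D * (x k * y k s)) = f b"
        using four_term_eq[of \<alpha> k c a s r t] by (simp add: b f_def X_def D_def x_def y_def)
    qed (auto simp: B_def)
    also have "\<dots> = (\<Sum>k\<le>l. \<Sum>s\<le>min i (l - k). D * (x k * y k s))"
      by (simp add: sum.Sigma)
    \<comment> \<open>the additional terms contain \<open>qbinom (l - k) s\<close> with \<open>s > l - k\<close>\<close>
    also have "\<dots> = (\<Sum>k\<le>l. \<Sum>s\<le>i. D * (x k * y k s))"
      by (intro sum.cong[OF refl] sum.mono_neutral_left) (auto simp: y_def qpoch_coeff_def qbinom_def)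
    also have "\<dots> = D * (\<Sum>k\<le>l. x k * (\<Sum>s\<le>i. y k s))"
      by (simp only: sum_distrib_left)
    also have "\<dots> = partial_theta_coeff q i * a ^ i * (qpoch (\<alpha> * q) q l * euler c l)"
      unfolding x_def y_def theta_coefficient_identity by (simp add: D_def euler_def)
    finally have eq: "sum f B = partial_theta_coeff q i * a ^ i * (qpoch (\<alpha> * q) q l * euler c l)" .
    have "finite B"
      unfolding B_def by (rule finite_subset[of _ "{..l} \<times> {..i} \<times> {..i} \<times> {..l}"]) auto
    then show "(f has_sum partial_theta_coeff q i * a ^ i * (qpoch (\<alpha> * q) q l * euler c l)) B"
      by (rule has_sum_finiteI) (use eq in simp)
  qed
qed

text \<open>
Both evaluations of the five-fold series agree; the second one is a product of two single series.
\<close>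

lemma n_term_sums:
  "n_term \<alpha> a c sums (partial_theta q a * (\<Sum>l. qpoch (\<alpha> * q) q l * euler c l))"
proof -
  obtain S where S: "((\<lambda>((k, s, p), (r, t)). five_term \<alpha> a c k s p r t) has_sum S) UNIV"
    using five_term_summable unfolding summable_on_def by blast
  have "((\<lambda>(i, l). partial_theta_coeff q i * a ^ i * (qpoch (\<alpha> * q) q l * euler c l))
      has_sum partial_theta q a * (\<Sum>l. qpoch (\<alpha> * q) q l * euler c l)) (UNIV \<times> UNIV)"
    unfolding partial_theta_def
    by (intro has_sum_times norm_summable_on norm_summable_imp_has_sum summable_norm_theta
        summable_norm_qpoch_euler summable_sums summable_norm_cancel[OF summable_norm_theta]
        summable_norm_cancel[OF summable_norm_qpoch_euler])
  then have "S = partial_theta q a * (\<Sum>l. qpoch (\<alpha> * q) q l * euler c l)"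
    using five_term_product[OF S] has_sum_unique by simp blast
  then show ?thesis
    using has_sum_imp_sums[OF five_term_sum_by_n[OF S]] by simp
qed

section \<open>The terminating Heine series\<close>

text \<open>
Reversal of \<open>(q^(-n); q)\<^sub>k\<close>: each factor \<open>1 - q^(i-n)\<close> times \<open>q\<^sup>n\<close> is
\<open>-q\<^sup>i (1 - q^(n-i))\<close>.
\<close>

lemma qpoch_neg_power:
  assumes "k \<le> n"
  shows "qpoch (inverse (q ^ n)) q k * q ^ (n * k) = partial_theta_coeff q k * (qpoch q q n / qpoch q q (n - k))"
  using assms
proof (induction k)
  case (Suc k)
  have "qpoch q q (n - k) = qpoch q q (n - Suc k) * (1 - q ^ (n - k))"
    using Suc.prems qq_Suc[of "n - Suc k"] by (simp add: Suc_diff_Suc del: power_Suc)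
  then have 1: "qpoch q q n / qpoch q q (n - k) * (1 - q ^ (n - k)) = qpoch q q n / qpoch q q (n - Suc k)"
    using qq_nz[of "n - k"] by auto
  have "q ^ n = q ^ k * q ^ (n - k)" using Suc.prems by (simp flip: power_add)
  then have 2: "(1 - inverse (q ^ n) * q ^ k) * q ^ n = - (q ^ k) * (1 - q ^ (n - k))"
    using q_nz by (simp add: algebra_simps)
  have "qpoch (inverse (q ^ n)) q (Suc k) * q ^ (n * Suc k)
      = qpoch (inverse (q ^ n)) q k * q ^ (n * k) * ((1 - inverse (q ^ n) * q ^ k) * q ^ n)"
    by (simp add: qpoch_Suc power_add mult_ac)
  also have "\<dots> = partial_theta_coeff q k * (qpoch q q n / qpoch q q (n - k)) * (- (q ^ k) * (1 - q ^ (n - k)))"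
    unfolding 2 using Suc by simp
  also have "\<dots> = partial_theta_coeff q (Suc k) * (qpoch q q n / qpoch q q (n - k) * (1 - q ^ (n - k)))"
    by (simp add: partial_theta_coeff_Suc mult_ac)
  finally show ?case unfolding 1 .
qed simp

text \<open>
The factor \<open>(q^(-n); q)\<^sub>k\<close> is reversed, and \<open>(a b q^(n-1); q)\<^sub>k\<close> in the denominator cancels against the
first \<open>k\<close> factors of \<open>(a b q^(n-1); q)\<^sub>n\<close>. The sum may run up to \<open>n\<close> because
\<open>(q^(-m); q)\<^sub>k = 0\<close> for \<open>k > m\<close>.
\<close>

lemma V_expansion:
  assumes nz: "\<And>k. k \<le> min m n \<Longrightarrow> qpoch (a * b * q powi (int n - 1)) q k \<noteq> 0"
  shows "qpoch (a * b * q powi (int n - 1)) q n * V q m n a b / qpoch q q n =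
    (\<Sum>k\<le>n. qpoch (q powi (- int m)) q k * euler (b * q ^ m) k *
        (qpoch (a * b * q powi (int n - 1) * q ^ k) q (n - k) / qpoch q q (n - k)))"
proof -
  define Y where "Y = a * b * q powi (int n - 1)"
  have "qpoch (Y) q n * V q m n a b / qpoch q q n =
    (\<Sum>k\<le>min m n. qpoch (Y) q n / qpoch q q n * (qpoch (q powi (- int m)) q k * qpoch (q powi (- int n)) q k
       / qpoch (Y) q k * ((b * q ^ (m + n)) ^ k / qpoch q q k)))"
    unfolding V_eq_finite_sum[OF q_nz] Y_def by (simp add: sum_distrib_left sum_divide_distrib mult_ac)
  also have "\<dots> = (\<Sum>k\<le>min m n. qpoch (q powi (- int m)) q k * euler (b * q ^ m) k *
        (qpoch (Y * q ^ k) q (n - k) / qpoch q q (n - k)))"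
  proof (rule sum.cong[OF refl])
    fix k assume "k \<in> {..min m n}"
    then have k: "k \<le> min m n" "k \<le> n" by auto
    have 1: "qpoch (Y) q n = qpoch (Y) q k * qpoch (Y * q ^ k) q (n - k)"
      using qpoch_add[of "Y" q k "n - k"] k by simp
    have 2: "(b * q ^ (m + n)) ^ k = (b * q ^ m) ^ k * q ^ (n * k)"
      by (simp add: power_add power_mult power_mult_distrib)
    have "qpoch (Y) q n / qpoch q q n * (qpoch (q powi (- int m)) q k * qpoch (q powi (- int n)) q k
       / qpoch (Y) q k * ((b * q ^ (m + n)) ^ k / qpoch q q k))
     = qpoch (q powi (- int m)) q k * (b * q ^ m) ^ k / qpoch q q k * qpoch (Y * q ^ k) q (n - k) / qpoch q q n *
        (qpoch (inverse (q ^ n)) q k * q ^ (n * k))"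
      unfolding 1 2 using nz[OF k(1)] by (simp add: power_int_minus Y_def) (simp only: mult_ac)
    also have "\<dots> = qpoch (q powi (- int m)) q k * euler (b * q ^ m) k *
        (qpoch (Y * q ^ k) q (n - k) / qpoch q q (n - k))"
      unfolding qpoch_neg_power[OF k(2)] by (simp add: euler_def)
    finally show "qpoch (Y) q n / qpoch q q n * (qpoch (q powi (- int m)) q k * qpoch (q powi (- int n)) q k
       / qpoch (Y) q k * ((b * q ^ (m + n)) ^ k / qpoch q q k)) = \<dots>" .
  qed
  also have "\<dots> = (\<Sum>k\<le>n. qpoch (q powi (- int m)) q k * euler (b * q ^ m) k *
        (qpoch (Y * q ^ k) q (n - k) / qpoch q q (n - k)))"
    by (rule sum.mono_neutral_left) (auto simp: qpoch_neg_power_eq_0[OF q_nz])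
  finally show ?thesis unfolding Y_def .
qed

section \<open>The series U as an expansion in powers of b\<close>

text \<open>
The terms of \<open>U\<^sub>N\<close>, with \<open>\<beta>\<close> in place of \<open>q^(1-N)\<close>.
\<close>

definition U_summand :: "nat \<Rightarrow> complex \<Rightarrow> complex \<Rightarrow> nat \<Rightarrow> complex" where
  "U_summand N \<beta> b k = qpoch \<beta> q k / (qpoch q q k * qpoch (b * q ^ k) q N)
       * (1 - b * q ^ (2 * k)) * b ^ (2 * k) * q ^ (2 * k\<^sup>2 - k + N * k)"

text \<open>
The certificate for the recurrence of \<open>U\<close> in \<open>N\<close>. It vanishes at \<open>k = 0\<close>, and beyond the
point where \<open>(\<beta>; q)\<^sub>k\<close> vanishes.
\<close>

definition U_certificate :: "nat \<Rightarrow> complex \<Rightarrow> complex \<Rightarrow> nat \<Rightarrow> complex" where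
  "U_certificate N \<beta> b k = qpoch \<beta> q k * (1 - q ^ k) / ((1 - \<beta>) * qpoch q q k * qpoch (b * q ^ k) q N)
       * b ^ (2 * k) * q ^ (2 * k\<^sup>2 - k + N * k)"

text \<open>
The rational identity behind the certificate: \<open>y\<close> stands for \<open>q\<^sup>k\<close> and \<open>w\<close> for \<open>q\<^sup>N\<close>.
\<close>

lemma telescoping_identity:
  fixes w :: complex
  assumes "\<beta> * w = 1"
  shows "(1 - \<beta>) * (1 - b * y\<^sup>2) * y - (1 - \<beta> * y) * (1 - b * y\<^sup>2) * (1 - b * y * w)
      - b * w * y\<^sup>2 * (1 - \<beta> * y) * (1 - b * q * y\<^sup>2) * (1 - b * y)
    = (1 - \<beta> * y) * (b\<^sup>2 * y ^ 4 * q * w) * (1 - b * y) - (1 - y) * (1 - b * y * w)"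
  using assms by algebra

text \<open>
Passing from \<open>N = M + 1\<close> to \<open>N + 1\<close> replaces \<open>\<beta> q\<close> by \<open>\<beta>\<close>. Division by the common factor of all five
terms reduces the claim to \<open>telescoping_identity\<close>.
\<close>

lemma U_summand_telescopes:
  assumes \<beta>: "\<beta> * q ^ Suc M = 1" and b: "\<And>j. b * q ^ j \<noteq> 1"
  shows "U_summand (Suc (Suc M)) \<beta> b k - U_summand (Suc M) (\<beta> * q) b k
      - b * q ^ Suc M * U_summand (Suc M) (\<beta> * q) (b * q) k
    = U_certificate (Suc M) \<beta> b (Suc k) - U_certificate (Suc M) \<beta> b k"
proof -
  define N y w where "N = Suc M" and "y = q ^ k" and "w = q ^ N"
  define P R H D where "P = qpoch \<beta> q k" and "R = qpoch q q k"
    and "H = b ^ (2 * k) * q ^ (2 * k\<^sup>2 - k + N * k)" and "D = qpoch (b * q ^ Suc k) q M"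
  have \<beta>1: "1 - \<beta> \<noteq> 0"
    using \<beta> power_neq_1[of "Suc M"] by auto
  have nz: "1 - b * y \<noteq> 0" "1 - b * y * w \<noteq> 0" "R \<noteq> 0" "1 - q * y \<noteq> 0"
    using b[of k] b[of "k + N"] power_neq_1[of "Suc k"]
    by (auto simp: y_def w_def R_def power_add mult_ac)
  have "D \<noteq> 0"
    unfolding D_def qpoch_def using b[of "Suc k + _"] by (auto simp: power_add mult_ac)
  have d1: "qpoch (b * q ^ k) q N = (1 - b * y) * D"
    by (simp add: N_def qpoch_Suc_shift D_def y_def mult_ac)
  have d2: "qpoch (b * q ^ Suc k) q N = D * (1 - b * y * w)"
    by (simp add: N_def qpoch_Suc D_def y_def w_def mult_ac)
  have d3: "qpoch (b * q ^ k) q (Suc N) = (1 - b * y) * D * (1 - b * y * w)"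
    by (simp add: qpoch_Suc d1 y_def w_def)
  have p: "qpoch (\<beta> * q) q k = P * (1 - \<beta> * y) / (1 - \<beta>)"
    using qpoch_Suc[of \<beta> q k] qpoch_Suc_shift[of \<beta> q k] \<beta>1 by (simp add: P_def y_def field_simps)
  have "k \<le> 2 * k\<^sup>2" by (simp add: power2_eq_square)
  then obtain d where d: "2 * k\<^sup>2 = k + d" using le_Suc_ex by blast
  have "2 * (Suc k)\<^sup>2 = Suc k + (d + 4 * k + 1)"
    using d by (simp add: power2_eq_square)
  with d have "2 * (Suc k)\<^sup>2 - Suc k + N * Suc k = (2 * k\<^sup>2 - k + N * k) + (4 * k + 1 + N)"
    by simp
  then have e: "q ^ (2 * (Suc k)\<^sup>2 - Suc k + N * Suc k) = q ^ (2 * k\<^sup>2 - k + N * k) * (y ^ 4 * q * w)"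
    by (simp only: power_add) (simp add: y_def w_def mult_ac flip: power_mult)
  have y2: "q ^ (2 * k) = y\<^sup>2" "q ^ Suc k = q * y" by (simp_all add: y_def mult_2 power_add power2_eq_square)
  have t1: "U_summand (Suc N) \<beta> b k = P / (R * ((1 - b * y) * D * (1 - b * y * w))) * (1 - b * y\<^sup>2) * (H * y)"
    unfolding U_summand_def d3 y2 by (simp add: P_def R_def H_def y_def power_add)
  have t2: "U_summand N (\<beta> * q) b k = (P * (1 - \<beta> * y) / (1 - \<beta>)) / (R * ((1 - b * y) * D)) * (1 - b * y\<^sup>2) * H"
    unfolding U_summand_def d1 y2 p by (simp add: R_def H_def)
  have t3: "U_summand N (\<beta> * q) (b * q) k = (P * (1 - \<beta> * y) / (1 - \<beta>)) / (R * (D * (1 - b * y * w))) * (1 - b * q * y\<^sup>2) * (H * y\<^sup>2)"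
  proof -
    have "qpoch (b * q * q ^ k) q N = D * (1 - b * y * w)"
      using d2 by (simp add: mult_ac)
    moreover have "(b * q) ^ (2 * k) = b ^ (2 * k) * y\<^sup>2"
      by (simp add: power_mult_distrib y2(1))
    ultimately show ?thesis
      unfolding U_summand_def p y2(1) by (simp add: R_def H_def)
  qed
  have t4: "U_certificate N \<beta> b k = P * (1 - y) / ((1 - \<beta>) * R * ((1 - b * y) * D)) * H"
    unfolding U_certificate_def d1 by (simp add: P_def R_def H_def y_def)
  have t5: "U_certificate N \<beta> b (Suc k) = P * (1 - \<beta> * y) / ((1 - \<beta>) * R * (D * (1 - b * y * w))) * (H * (b\<^sup>2 * y ^ 4 * q * w))"
  proof -
    have "U_certificate N \<beta> b (Suc k) = (P * (1 - \<beta> * y)) * (1 - q * y) / ((1 - \<beta>) * (R * (1 - q * y)) * (D * (1 - b * y * w)))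
        * b ^ (2 * Suc k) * (q ^ (2 * k\<^sup>2 - k + N * k) * (y ^ 4 * q * w))"
      unfolding U_certificate_def d2 e qq_Suc qpoch_Suc[of \<beta>] unfolding y2 by (simp add: P_def R_def y_def)
    then show ?thesis
      using nz by (simp add: H_def power2_eq_square) (simp only: mult_ac)
  qed
  \<comment> \<open>the common factor of all five terms, over their common denominator\<close>
  define Z where "Z = P * H / ((1 - \<beta>) * R * (1 - b * y) * D * (1 - b * y * w))"
  have "U_summand (Suc N) \<beta> b k - U_summand N (\<beta> * q) b k - b * w * U_summand N (\<beta> * q) (b * q) k
     = Z * ((1 - \<beta>) * (1 - b * y\<^sup>2) * y - (1 - \<beta> * y) * (1 - b * y\<^sup>2) * (1 - b * y * w)
      - b * w * y\<^sup>2 * (1 - \<beta> * y) * (1 - b * q * y\<^sup>2) * (1 - b * y))"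
    unfolding t1 t2 t3 Z_def using nz \<beta>1 \<open>D \<noteq> 0\<close> by (simp add: divide_simps) (simp add: algebra_simps)
  also have "\<dots> = Z * ((1 - \<beta> * y) * (b\<^sup>2 * y ^ 4 * q * w) * (1 - b * y) - (1 - y) * (1 - b * y * w))"
    using \<beta> by (subst telescoping_identity) (simp_all add: w_def N_def)
  also have "\<dots> = U_certificate N \<beta> b (Suc k) - U_certificate N \<beta> b k"
    unfolding t4 t5 Z_def using nz \<beta>1 \<open>D \<noteq> 0\<close> by (simp add: divide_simps) (simp add: algebra_simps)
  finally show ?thesis unfolding w_def N_def .
qed

lemma qpoch_eq_0:
  assumes "\<beta> * q ^ N = 1" "N < n"
  shows "qpoch \<beta> q n = 0"
  unfolding qpoch_def using assms by (intro prod_zero) auto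

text \<open>
The same recurrence for the expansion in powers of \<open>b\<close>, coefficient by coefficient; for
\<open>\<beta> = q^(-N)\<close> and \<open>w = q\<^sup>N\<close> it is a Pascal rule for q-binomial coefficients.
\<close>

lemma U_polynomial_step:
  assumes "\<beta> \<noteq> 1"
  shows "qpoch \<beta> q (Suc l) * euler (b * w * q) (Suc l) - qpoch (\<beta> * q) q (Suc l) * euler (b * w) (Suc l)
    = b * w * (qpoch (\<beta> * q) q l * euler (b * w * q) l)"
proof -
  have "1 - q ^ Suc l \<noteq> 0" using power_neq_1[of "Suc l"] by simp
  then have 1: "euler x (Suc l) * (1 - q ^ Suc l) = - (q ^ l) * x * euler x l" for x
    by (simp add: euler_def partial_theta_coeff_Suc qq_Suc del: power_Suc) simp
  have 2: "euler (b * w * q) n = euler (b * w) n * q ^ n" for n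
    by (simp add: euler_mult_power)
  have "qpoch \<beta> q (Suc l) * euler (b * w * q) (Suc l) - qpoch (\<beta> * q) q (Suc l) * euler (b * w) (Suc l)
     = qpoch (\<beta> * q) q l * euler (b * w) (Suc l) * ((1 - \<beta>) * q ^ Suc l - (1 - \<beta> * q * q ^ l))"
    unfolding qpoch_Suc_shift[of \<beta>] qpoch_Suc[of "\<beta> * q"] 2
    by (simp add: algebra_simps)
  also have "\<dots> = qpoch (\<beta> * q) q l * - (euler (b * w) (Suc l) * (1 - q ^ Suc l))"
    by (simp add: algebra_simps)
  also have "\<dots> = b * w * (qpoch (\<beta> * q) q l * euler (b * w * q) l)"
    unfolding 1 2 by simp
  finally show ?thesis .
qed

text \<open>
Both sums terminate at \<open>N\<close>. Any bound \<open>n > N\<close> is allowed so that the induction hypothesis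
applies with the same bound.
\<close>

lemma U_summand_sum_eq:
  assumes "\<beta> * q ^ N = 1" and "\<And>j. b * q ^ j \<noteq> 1" and "N < n"
  shows "(\<Sum>k<n. U_summand (Suc N) \<beta> b k) = (\<Sum>l<n. qpoch \<beta> q l * euler (b * q ^ Suc N) l)"
  using assms
proof (induction N arbitrary: \<beta> b n)
  case 0
  obtain n' where n: "n = Suc n'" using 0 by (cases n) auto
  have "U_summand (Suc 0) \<beta> b (Suc k) = 0" "qpoch \<beta> q (Suc k) = 0" for k
    using qpoch_eq_0[OF 0(1), of "Suc k"] by (auto simp: U_summand_def)
  moreover have "U_summand (Suc 0) \<beta> b 0 = 1"
    using 0(2)[of 0] by (simp add: U_summand_def qpoch_def)
  ultimately show ?case
    unfolding n sum.lessThan_Suc_shift by simp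
next
  case (Suc N)
  obtain n' where n: "n = Suc n'" using Suc.prems by (cases n) auto
  have \<beta>q: "\<beta> * q * q ^ N = 1" using Suc.prems by (simp add: mult_ac)
  have "\<beta> \<noteq> 1" using Suc.prems(1) power_neq_1[of "Suc N"] by auto
  have bq: "b * q * q ^ j \<noteq> 1" for j using Suc.prems(2)[of "Suc j"] by (simp add: mult_ac)
  have "(\<Sum>k<n. U_summand (Suc (Suc N)) \<beta> b k) - (\<Sum>k<n. U_summand (Suc N) (\<beta> * q) b k)
      - b * q ^ Suc N * (\<Sum>k<n. U_summand (Suc N) (\<beta> * q) (b * q) k)
     = (\<Sum>k<n. U_certificate (Suc N) \<beta> b (Suc k) - U_certificate (Suc N) \<beta> b k)"
    unfolding sum_distrib_left sum_subtractf[symmetric]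
    by (intro sum.cong[OF refl] U_summand_telescopes Suc.prems)
  also have "\<dots> = 0"
    unfolding sum_lessThan_telescope
    using qpoch_eq_0[OF Suc.prems(1,3)] by (simp add: U_certificate_def)
  finally have "(\<Sum>k<n. U_summand (Suc (Suc N)) \<beta> b k) = (\<Sum>l<n. qpoch (\<beta> * q) q l * euler (b * q ^ Suc N) l)
      + b * q ^ Suc N * (\<Sum>l<n. qpoch (\<beta> * q) q l * euler (b * q * q ^ Suc N) l)"
    using Suc.IH[OF \<beta>q Suc.prems(2), of n] Suc.IH[OF \<beta>q bq, of n] Suc.prems(3) by (simp add: algebra_simps)
  \<comment> \<open>dropping a vanishing last term, so that the shift \<open>l \<mapsto> l + 1\<close> fits\<close>
  also have "(\<Sum>l<n. qpoch (\<beta> * q) q l * euler (b * q * q ^ Suc N) l)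
      = (\<Sum>l<n'. qpoch (\<beta> * q) q l * euler (b * q ^ Suc N * q) l)"
    using qpoch_eq_0[OF \<beta>q, of n'] Suc.prems(3) by (simp add: n mult_ac)
  also have "(\<Sum>l<n. qpoch (\<beta> * q) q l * euler (b * q ^ Suc N) l)
      + b * q ^ Suc N * (\<Sum>l<n'. qpoch (\<beta> * q) q l * euler (b * q ^ Suc N * q) l)
      = (\<Sum>l<n. qpoch \<beta> q l * euler (b * q ^ Suc N * q) l)"
    unfolding n sum.lessThan_Suc_shift sum_distrib_left U_polynomial_step[OF \<open>\<beta> \<noteq> 1\<close>, symmetric]
    by (simp add: sum_subtractf)
  finally show ?case by (simp add: mult_ac)
qed

lemma U_sums_pos:
  assumes b: "\<And>j. b * q ^ j \<noteq> 1"
  shows "U_term q (Suc N) b sums (\<Sum>l. qpoch (q powi (- int N)) q l * euler (b * q ^ Suc N) l)"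
proof -
  let ?\<beta> = "q powi (- int N)"
  have \<beta>: "?\<beta> * q ^ N = 1" using q_nz by (simp add: power_int_minus)
  have eq: "U_term q (Suc N) b k = U_summand (Suc N) ?\<beta> b k" for k
    by (simp add: U_term_def U_summand_def)
  have z: "qpoch ?\<beta> q k = 0" if "k \<notin> {..<Suc N}" for k
    using qpoch_eq_0[OF \<beta>, of k] that by auto
  have "U_term q (Suc N) b sums (\<Sum>k<Suc N. U_term q (Suc N) b k)"
    by (rule sums_finite) (auto simp: U_term_def z)
  also have "(\<Sum>k<Suc N. U_term q (Suc N) b k) = (\<Sum>l<Suc N. qpoch ?\<beta> q l * euler (b * q ^ Suc N) l)"
    unfolding eq by (rule U_summand_sum_eq[OF \<beta> b]) simp
  also have "\<dots> = (\<Sum>l. qpoch ?\<beta> q l * euler (b * q ^ Suc N) l)"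
    by (rule suminf_finite[symmetric]) (auto simp: z)
  finally show ?thesis .
qed

text \<open>
For \<open>m = 0\<close> the terms of \<open>U\<close> are \<open>\<tau>(2 k) b^(2k) + \<tau>(2 k + 1) b^(2k+1)\<close>.
\<close>

lemma U_sums_0: "U_term q 0 b sums (\<Sum>l. qpoch q q l * euler b l)"
proof -
  have "(\<lambda>n. partial_theta_coeff q n * b ^ n) sums (\<Sum>n. partial_theta_coeff q n * b ^ n)"
    by (rule summable_sums[OF summable_norm_cancel[OF summable_norm_theta]])
  then have "(\<lambda>n. \<Sum>i\<in>{n * 2..<n * 2 + 2}. partial_theta_coeff q i * b ^ i) sums (\<Sum>n. partial_theta_coeff q n * b ^ n)"
    by (rule sums_group) simp
  moreover have "(\<Sum>i\<in>{k * 2..<k * 2 + 2}. partial_theta_coeff q i * b ^ i) = U_term q 0 b k" for k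
  proof -
    have "(2 * k) * (2 * k - 1) div 2 = 2 * k\<^sup>2 - k"
      by (simp add: power2_eq_square algebra_simps diff_mult_distrib2)
    then have e: "partial_theta_coeff q (2 * k) = q ^ (2 * k\<^sup>2 - k)"
      by (simp add: partial_theta_coeff_def)
    have "{k * 2..<k * 2 + 2} = {2 * k, Suc (2 * k)}" by auto
    then have "(\<Sum>i\<in>{k * 2..<k * 2 + 2}. partial_theta_coeff q i * b ^ i)
       = q ^ (2 * k\<^sup>2 - k) * b ^ (2 * k) * (1 - b * q ^ (2 * k))"
      by (simp add: partial_theta_coeff_Suc e) (simp add: algebra_simps)
    also have "\<dots> = U_term q 0 b k"
      by (simp add: U_term_def)
    finally show ?thesis .
  qed
  ultimately show ?thesis by (simp add: euler_def)
qed

lemma U_sums: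
  assumes b: "\<And>j. b * q ^ j \<noteq> 1"
  shows "U_term q m b sums (\<Sum>l. qpoch (q powi (- int m) * q) q l * euler (b * q ^ m) l)"
proof (cases m)
  case 0
  then show ?thesis using U_sums_0 by simp
next
  case (Suc N)
  have "q powi (- int m) * q = q powi (- int N)"
    using power_int_add_1[of q "- int m"] q_nz by (simp add: Suc)
  then show ?thesis using U_sums_pos[OF b, of N] by (simp add: Suc)
qed

end

section \<open>The product formula\<close>

theorem theorem1p7:
  fixes q a b :: complex and m :: nat
  assumes q: "0 < norm q" "norm q < 1"
    and a_denom: "\<And>n. qpoch a q n \<noteq> 0"
    and b_denom: "\<And>n. qpoch b q (m + n) \<noteq> 0"
    and U_denom: "\<And>k. qpoch (b * q ^ k) q m \<noteq> 0"
    and V_denom: "\<And>n k. k \<le> min m n \<Longrightarrow> qpoch (a * b * q powi (int n - 1)) q k \<noteq> 0"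
  shows "summable (U_term q m b)
    \<and> summable (\<lambda>n. partial_theta_coeff q n * a ^ n)
    \<and> summable (\<lambda>n. qpoch (a * b * q powi (int n - 1)) q n * q ^ n / (qpoch q q n * qpoch a q n)
           * (V q m n a b / qpoch b q (m + n)))
    \<and> U q m b * partial_theta q a =
         qpoch_inf q q * qpoch_inf a q * qpoch_inf b q *
         (\<Sum>n. qpoch (a * b * q powi (int n - 1)) q n * q ^ n / (qpoch q q n * qpoch a q n)
           * (V q m n a b / qpoch b q (m + n)))"
proof -
  interpret nome q using q by unfold_locales
  let ?R = "\<lambda>n. qpoch (a * b * q powi (int n - 1)) q n * q ^ n / (qpoch q q n * qpoch a q n)
           * (V q m n a b / qpoch b q (m + n))"
  define P where "P = qpoch_inf q q * qpoch_inf a q * qpoch_inf b q"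
  let ?\<alpha> = "q powi (- int m)"
  \<comment> \<open>the hypothesis on \<open>(b; q)_(m+n)\<close> implies that \<open>b q\<^sup>j \<noteq> 1\<close> for every \<open>j\<close>, since \<open>n\<close> is arbitrary\<close>
  have b_nz: "qpoch b q n \<noteq> 0" for n
    using b_denom[of n] qpoch_add[of b q n m] by (auto simp: add.commute)
  have b: "b * q ^ j \<noteq> 1" for j
    using b_nz[of "Suc j"] by (auto simp: qpoch_Suc)
  have U: "U_term q m b sums (\<Sum>l. qpoch (?\<alpha> * q) q l * euler (b * q ^ m) l)"
    by (rule U_sums[OF b])
  have P_nz: "P \<noteq> 0"
    unfolding P_def using qpoch_inf_nz[of q] qpoch_inf_nz[of a] qpoch_inf_nz[of b] a_denom b_nz by simp
  have ab: "a * (b * q ^ m) * ?\<alpha> = a * b"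
    using q_nz by (simp add: power_int_minus)
  have "P * ?R n = n_term ?\<alpha> a (b * q ^ m) n" for n
  proof -
    have V: "qpoch (a * b * q powi (int n - 1)) q n * V q m n a b / qpoch q q n =
      (\<Sum>k\<le>n. qpoch ?\<alpha> q k * euler (b * q ^ m) k *
        (qpoch (a * b * q powi (int n - 1) * q ^ k) q (n - k) / qpoch q q (n - k)))"
      by (rule V_expansion) (rule V_denom)
    have "n_term ?\<alpha> a (b * q ^ m) n
       = qpoch_inf q q * qpoch_inf (a * q ^ n) q * qpoch_inf (b * q ^ (m + n)) q * q ^ n *
         (qpoch (a * b * q powi (int n - 1)) q n * V q m n a b / qpoch q q n)"
      unfolding n_term_def ab V
      by (simp add: power_add mult_ac)
    then show ?thesis
      unfolding P_def qpoch_inf_split[of a n] qpoch_inf_split[of b "m + n"]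
      using a_denom[of n] b_denom[of n] by simp
  qed
  then have S: "(\<lambda>n. P * ?R n) sums (partial_theta q a * U q m b)"
    using n_term_sums[of ?\<alpha> a "b * q ^ m"] U by (simp add: U_def sums_iff)
  have summ: "summable ?R"
    using S P_nz sums_summable summable_cmult_iff by blast
  moreover have "P * (\<Sum>n. ?R n) = partial_theta q a * U q m b"
    by (rule trans[OF suminf_mult[OF summ, symmetric] sums_unique[OF S, symmetric]])
  moreover have "summable (U_term q m b)"
    using U by (rule sums_summable)
  moreover have "summable (\<lambda>n. partial_theta_coeff q n * a ^ n)"
    by (rule summable_norm_cancel[OF summable_norm_theta])
  ultimately show ?thesis unfolding P_def by (simp add: mult.commute)
qed

end
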